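(* Let $S$ be a discrete semigroup and $\varphi\in\Delta_S(S)$. Then $S$ is $\varphi$-amenable if and only if the Banach algebra $\ell^1(S)$ is $\widehat{\varphi}$-amenable.
   Context: A character on a discrete semigroup $S$ is a nonzero map $\varphi:S\to\mathbb{T}$ (the unit circle) with $\varphi(st)=\varphi(s)\varphi(t)$ for all $s,t$; $\Delta_S(S)$ is the set of characters. $\ell^1(S)$ is the semigroup algebra with convolution, and $\widehat{\varphi}:\ell^1(S)\to\mathbb{C}$, $\widehat{\varphi}(f)=\sum_{s\in S}\varphi(s)f(s)$, is the character on $\ell^1(S)$ induced by $\varphi$. A Banach $S$-bimodule is a Banach space $X$ with commuting left and right actions of $S$ by linear operators, uniformly bounded in $s$. The dual $X^*$ is a bimodule via $(s\cdot f)(x)=f(x\cdot s)$, $(f\cdot s)(x)=f(s\cdot x)$. Let ${}_\varphi\mathcal{M}^S$ (resp. $\mathcal{M}_\varphi^S$) be the class of Banach $S$-bimodules with $s\cdot x=\varphi(s)x$ (resp. $x\cdot s=\varphi(s)x$) for all $s,x$. A bounded derivation is a map $D:S\to X^*$ with $D(st)=s\cdot D(t)+D(s)\cdot t$ and $\sup_s\|D(s)\|<\infty$; it is principal if $D(s)=s\cdot f-f\cdot s$ for some $f\in X^*$ and all $s$. $S$ is left (resp. right) $\varphi$-amenable if for each $X\in{}_\varphi\mathcal{M}^S$ (resp. $X\in\mathcal{M}_\varphi^S$) every bounded derivation $D:S\to X^*$ is principal; $S$ is $\varphi$-amenable if it is both. For a Banach algebra $\mathfrak{A}$ and a character $\psi$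 of $\mathfrak{A}$, $\mathfrak{A}$ is $\psi$-amenable if, for every Banach $\mathfrak{A}$-bimodule $X$ whose left action is $a\cdot x=\psi(a)x$, and also for every Banach $\mathfrak{A}$-bimodule $X$ whose right action is $x\cdot a=\psi(a)x$, every continuous derivation $D:\mathfrak{A}\to X^*$ is inner. *)

theory Defs
  imports "HOL-Analysis.Analysis"
begin

section \<open>Complex Banach spaces with explicit carriers\<close>

text \<open>
  Amenability quantifies over all Banach bimodules. Spaces are therefore records with an explicit
  carrier, so that inside a formula one can quantify over every Banach space whose
  elements lie in a given type. Outside the carrier the operations are irrelevant.
\<close>

record 'x nspace =
  vcarrier :: "'x set"
  vadd :: "'x \<Rightarrow> 'x \<Rightarrow> 'x"
  vzero :: "'x"
  vscale :: "complex \<Rightarrow> 'x \<Rightarrow> 'x"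
  vnorm :: "'x \<Rightarrow> real"

definition vminus :: "('x, 'm) nspace_scheme \<Rightarrow> 'x \<Rightarrow> 'x \<Rightarrow> 'x" where
  "vminus X x y = vadd X x (vscale X (-1) y)"

locale complex_normed_space =
  fixes X :: "('x, 'm) nspace_scheme"
  assumes zero_closed: "vzero X \<in> vcarrier X"
    and add_closed: "\<lbrakk>x \<in> vcarrier X; y \<in> vcarrier X\<rbrakk> \<Longrightarrow> vadd X x y \<in> vcarrier X"
    and scale_closed: "x \<in> vcarrier X \<Longrightarrow> vscale X c x \<in> vcarrier X"
    and add_assoc: "\<lbrakk>x \<in> vcarrier X; y \<in> vcarrier X; z \<in> vcarrier X\<rbrakk>
          \<Longrightarrow> vadd X (vadd X x y) z = vadd X x (vadd X y z)"
    and add_commute: "\<lbrakk>x \<in> vcarrier X; y \<in> vcarrier X\<rbrakk> \<Longrightarrow> vadd X x y = vadd X y x"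
    and add_zero: "x \<in> vcarrier X \<Longrightarrow> vadd X x (vzero X) = x"
    and minus_self: "x \<in> vcarrier X \<Longrightarrow> vminus X x x = vzero X"
    and scale_one: "x \<in> vcarrier X \<Longrightarrow> vscale X 1 x = x"
    and scale_scale: "x \<in> vcarrier X \<Longrightarrow> vscale X c (vscale X d x) = vscale X (c * d) x"
    and scale_add_right: "\<lbrakk>x \<in> vcarrier X; y \<in> vcarrier X\<rbrakk>
          \<Longrightarrow> vscale X c (vadd X x y) = vadd X (vscale X c x) (vscale X c y)"
    and scale_add_left: "x \<in> vcarrier X
          \<Longrightarrow> vscale X (c + d) x = vadd X (vscale X c x) (vscale X d x)"
    and norm_nonneg: "x \<in> vcarrier X \<Longrightarrow> 0 \<le> vnorm X x"
    and norm_eq_zero: "x \<in> vcarrier X \<Longrightarrow> vnorm X x = 0 \<longleftrightarrow> x = vzero X"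
    and norm_triangle: "\<lbrakk>x \<in> vcarrier X; y \<in> vcarrier X\<rbrakk>
          \<Longrightarrow> vnorm X (vadd X x y) \<le> vnorm X x + vnorm X y"
    and norm_scale: "x \<in> vcarrier X \<Longrightarrow> vnorm X (vscale X c x) = cmod c * vnorm X x"

text \<open>The locale \<open>Metric_space\<close> wants a metric that is symmetric and nonnegative on the whole
  type, hence the default value off the carrier.\<close>

definition vdist :: "('x, 'm) nspace_scheme \<Rightarrow> 'x \<Rightarrow> 'x \<Rightarrow> real" where
  "vdist X x y = (if x \<in> vcarrier X \<and> y \<in> vcarrier X then vnorm X (vminus X x y) else 0)"

definition norm_topology :: "('x, 'm) nspace_scheme \<Rightarrow> 'x topology" where
  "norm_topology X = Metric_space.mtopology (vcarrier X) (vdist X)"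

locale complex_banach_space = complex_normed_space X
  for X :: "('x, 'm) nspace_scheme" +
  assumes complete: "Metric_space.mcomplete (vcarrier X) (vdist X)"

definition linear_map ::
    "('x, 'm) nspace_scheme \<Rightarrow> ('y, 'n) nspace_scheme \<Rightarrow> ('x \<Rightarrow> 'y) \<Rightarrow> bool" where
  "linear_map X Y T \<longleftrightarrow>
     (\<forall>x\<in>vcarrier X. T x \<in> vcarrier Y) \<and>
     (\<forall>x\<in>vcarrier X. \<forall>y\<in>vcarrier X. T (vadd X x y) = vadd Y (T x) (T y)) \<and>
     (\<forall>c. \<forall>x\<in>vcarrier X. T (vscale X c x) = vscale Y c (T x))"

definition complex_space :: "complex nspace" where
  "complex_space = \<lparr>vcarrier = UNIV, vadd = (+), vzero = 0, vscale = (*), vnorm = cmod\<rparr>"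

text \<open>The dual space: bounded linear functionals with the operator norm. Functionals are taken
  to be \<open>extensional\<close>, so that two of them are equal iff they agree on the carrier.\<close>

definition dual :: "('x, 'm) nspace_scheme \<Rightarrow> ('x \<Rightarrow> complex) nspace" where
  "dual X = \<lparr>
     vcarrier = {f \<in> extensional (vcarrier X). linear_map X complex_space f \<and>
                   (\<exists>C. \<forall>x\<in>vcarrier X. cmod (f x) \<le> C * vnorm X x)},
     vadd = (\<lambda>f g. \<lambda>x\<in>vcarrier X. f x + g x),
     vzero = (\<lambda>x\<in>vcarrier X. 0),
     vscale = (\<lambda>c f. \<lambda>x\<in>vcarrier X. c * f x),
     vnorm = (\<lambda>f. Sup ((\<lambda>x. cmod (f x)) ` {x \<in> vcarrier X. vnorm X x \<le> 1}))\<rparr>"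

text \<open>The actions on the dual induced by a left action \<open>l\<close> and a right action \<open>r\<close> on \<open>X\<close>
  (both written with the acting element first, so \<open>r s x\<close> is $x \cdot s$):
  $(s\cdot f)(x) = f(x\cdot s)$ and $(f\cdot s)(x) = f(s\cdot x)$.\<close>

definition dual_left ::
    "('x, 'm) nspace_scheme \<Rightarrow> ('s \<Rightarrow> 'x \<Rightarrow> 'x) \<Rightarrow> 's \<Rightarrow> ('x \<Rightarrow> complex) \<Rightarrow> 'x \<Rightarrow> complex" where
  "dual_left X r s f = (\<lambda>x\<in>vcarrier X. f (r s x))"

definition dual_right ::
    "('x, 'm) nspace_scheme \<Rightarrow> ('s \<Rightarrow> 'x \<Rightarrow> 'x) \<Rightarrow> ('x \<Rightarrow> complex) \<Rightarrow> 's \<Rightarrow> 'x \<Rightarrow> complex" where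
  "dual_right X l f s = (\<lambda>x\<in>vcarrier X. f (l s x))"


section \<open>Semigroups\<close>

text \<open>Being unimodular, a character on the (nonempty) semigroup is automatically nonzero.\<close>

definition semigroup_characters :: "('s::semigroup_mult \<Rightarrow> complex) set" where
  "semigroup_characters =
     {\<phi>. (\<forall>s. \<phi> s \<in> sphere 0 1) \<and> (\<forall>s t. \<phi> (s * t) = \<phi> s * \<phi> t)}"

definition semigroup_bimodule ::
    "'x nspace \<Rightarrow> ('s::semigroup_mult \<Rightarrow> 'x \<Rightarrow> 'x) \<Rightarrow> ('s \<Rightarrow> 'x \<Rightarrow> 'x) \<Rightarrow> bool" where
  "semigroup_bimodule X l r \<longleftrightarrow>
     complex_banach_space X \<and>
     (\<forall>s. linear_map X X (l s)) \<and>
     (\<forall>s. linear_map X X (r s)) \<and>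
     (\<forall>s t. \<forall>x\<in>vcarrier X. l (s * t) x = l s (l t x)) \<and>
     (\<forall>s t. \<forall>x\<in>vcarrier X. r (s * t) x = r t (r s x)) \<and>
     (\<forall>s t. \<forall>x\<in>vcarrier X. l s (r t x) = r t (l s x)) \<and>
     (\<exists>C. \<forall>s. \<forall>x\<in>vcarrier X. vnorm X (l s x) \<le> C * vnorm X x) \<and>
     (\<exists>C. \<forall>s. \<forall>x\<in>vcarrier X. vnorm X (r s x) \<le> C * vnorm X x)"

definition semigroup_bounded_derivation ::
    "'x nspace \<Rightarrow> ('s::semigroup_mult \<Rightarrow> 'x \<Rightarrow> 'x) \<Rightarrow> ('s \<Rightarrow> 'x \<Rightarrow> 'x)
      \<Rightarrow> ('s \<Rightarrow> 'x \<Rightarrow> complex) \<Rightarrow> bool" where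
  "semigroup_bounded_derivation X l r D \<longleftrightarrow>
     (\<forall>s. D s \<in> vcarrier (dual X)) \<and>
     (\<forall>s t. D (s * t) = vadd (dual X) (dual_left X r s (D t)) (dual_right X l (D s) t)) \<and>
     bdd_above (range (\<lambda>s. vnorm (dual X) (D s)))"

definition semigroup_principal ::
    "'x nspace \<Rightarrow> ('s::semigroup_mult \<Rightarrow> 'x \<Rightarrow> 'x) \<Rightarrow> ('s \<Rightarrow> 'x \<Rightarrow> 'x)
      \<Rightarrow> ('s \<Rightarrow> 'x \<Rightarrow> complex) \<Rightarrow> bool" where
  "semigroup_principal X l r D \<longleftrightarrow>
     (\<exists>f\<in>vcarrier (dual X). \<forall>s.
        D s = vminus (dual X) (dual_left X r s f) (dual_right X l f s))"

text \<open>The type argument is the type from which the elements of the Banach spaces \<open>X\<close> are drawn.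
  It plays the role of a universe: HOL cannot quantify over types inside a definition.\<close>

definition semigroup_left_amenable ::
    "'x itself \<Rightarrow> ('s::semigroup_mult \<Rightarrow> complex) \<Rightarrow> bool" where
  "semigroup_left_amenable TYPE('x) \<phi> \<longleftrightarrow>
     (\<forall>(X :: 'x nspace) l r. semigroup_bimodule X l r \<and>
        (\<forall>s. \<forall>x\<in>vcarrier X. l s x = vscale X (\<phi> s) x) \<longrightarrow>
        (\<forall>D. semigroup_bounded_derivation X l r D \<longrightarrow> semigroup_principal X l r D))"

definition semigroup_right_amenable ::
    "'x itself \<Rightarrow> ('s::semigroup_mult \<Rightarrow> complex) \<Rightarrow> bool" where
  "semigroup_right_amenable TYPE('x) \<phi> \<longleftrightarrow>
     (\<forall>(X :: 'x nspace) l r. semigroup_bimodule X l r \<and>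
        (\<forall>s. \<forall>x\<in>vcarrier X. r s x = vscale X (\<phi> s) x) \<longrightarrow>
        (\<forall>D. semigroup_bounded_derivation X l r D \<longrightarrow> semigroup_principal X l r D))"

definition semigroup_amenable ::
    "'x itself \<Rightarrow> ('s::semigroup_mult \<Rightarrow> complex) \<Rightarrow> bool" where
  "semigroup_amenable TYPE('x) \<phi> \<longleftrightarrow>
     semigroup_left_amenable TYPE('x) \<phi> \<and> semigroup_right_amenable TYPE('x) \<phi>"


section \<open>Banach algebras\<close>

record 'a nalgebra = "'a nspace" +
  amult :: "'a \<Rightarrow> 'a \<Rightarrow> 'a"

locale complex_banach_algebra = complex_banach_space A
  for A :: "'a nalgebra" +
  assumes mult_assoc: "\<lbrakk>a \<in> vcarrier A; b \<in> vcarrier A; c \<in> vcarrier A\<rbrakk>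
          \<Longrightarrow> amult A (amult A a b) c = amult A a (amult A b c)"
    and mult_linear_right: "a \<in> vcarrier A \<Longrightarrow> linear_map A A (amult A a)"
    and mult_linear_left: "b \<in> vcarrier A \<Longrightarrow> linear_map A A (\<lambda>a. amult A a b)"
    and norm_mult: "\<lbrakk>a \<in> vcarrier A; b \<in> vcarrier A\<rbrakk>
          \<Longrightarrow> vnorm A (amult A a b) \<le> vnorm A a * vnorm A b"

definition algebra_character :: "'a nalgebra \<Rightarrow> ('a \<Rightarrow> complex) \<Rightarrow> bool" where
  "algebra_character A \<psi> \<longleftrightarrow>
     linear_map A complex_space \<psi> \<and>
     (\<forall>a\<in>vcarrier A. \<forall>b\<in>vcarrier A. \<psi> (amult A a b) = \<psi> a * \<psi> b) \<and>
     (\<exists>a\<in>vcarrier A. \<psi> a \<noteq> 0)"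

definition algebra_bimodule ::
    "'a nalgebra \<Rightarrow> 'x nspace \<Rightarrow> ('a \<Rightarrow> 'x \<Rightarrow> 'x) \<Rightarrow> ('a \<Rightarrow> 'x \<Rightarrow> 'x) \<Rightarrow> bool" where
  "algebra_bimodule A X l r \<longleftrightarrow>
     complex_banach_space X \<and>
     (\<forall>a\<in>vcarrier A. linear_map X X (l a)) \<and>
     (\<forall>a\<in>vcarrier A. linear_map X X (r a)) \<and>
     (\<forall>x\<in>vcarrier X. linear_map A X (\<lambda>a. l a x)) \<and>
     (\<forall>x\<in>vcarrier X. linear_map A X (\<lambda>a. r a x)) \<and>
     (\<forall>a\<in>vcarrier A. \<forall>b\<in>vcarrier A. \<forall>x\<in>vcarrier X. l (amult A a b) x = l a (l b x)) \<and>
     (\<forall>a\<in>vcarrier A. \<forall>b\<in>vcarrier A. \<forall>x\<in>vcarrier X. r (amult A a b) x = r b (r a x)) \<and>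
     (\<forall>a\<in>vcarrier A. \<forall>b\<in>vcarrier A. \<forall>x\<in>vcarrier X. l a (r b x) = r b (l a x)) \<and>
     (\<exists>C. \<forall>a\<in>vcarrier A. \<forall>x\<in>vcarrier X. vnorm X (l a x) \<le> C * vnorm A a * vnorm X x) \<and>
     (\<exists>C. \<forall>a\<in>vcarrier A. \<forall>x\<in>vcarrier X. vnorm X (r a x) \<le> C * vnorm A a * vnorm X x)"

definition algebra_continuous_derivation ::
    "'a nalgebra \<Rightarrow> 'x nspace \<Rightarrow> ('a \<Rightarrow> 'x \<Rightarrow> 'x) \<Rightarrow> ('a \<Rightarrow> 'x \<Rightarrow> 'x)
      \<Rightarrow> ('a \<Rightarrow> 'x \<Rightarrow> complex) \<Rightarrow> bool" where
  "algebra_continuous_derivation A X l r D \<longleftrightarrow>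
     linear_map A (dual X) D \<and>
     (\<forall>a\<in>vcarrier A. \<forall>b\<in>vcarrier A.
        D (amult A a b) = vadd (dual X) (dual_left X r a (D b)) (dual_right X l (D a) b)) \<and>
     continuous_map (norm_topology A) (norm_topology (dual X)) D"

definition algebra_inner ::
    "'a nalgebra \<Rightarrow> 'x nspace \<Rightarrow> ('a \<Rightarrow> 'x \<Rightarrow> 'x) \<Rightarrow> ('a \<Rightarrow> 'x \<Rightarrow> 'x)
      \<Rightarrow> ('a \<Rightarrow> 'x \<Rightarrow> complex) \<Rightarrow> bool" where
  "algebra_inner A X l r D \<longleftrightarrow>
     (\<exists>f\<in>vcarrier (dual X). \<forall>a\<in>vcarrier A.
        D a = vminus (dual X) (dual_left X r a f) (dual_right X l f a))"

definition algebra_amenable :: "'x itself \<Rightarrow> 'a nalgebra \<Rightarrow> ('a \<Rightarrow> complex) \<Rightarrow> bool" where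
  "algebra_amenable TYPE('x) A \<psi> \<longleftrightarrow>
     (\<forall>(X :: 'x nspace) l r. algebra_bimodule A X l r \<and>
        (\<forall>a\<in>vcarrier A. \<forall>x\<in>vcarrier X. l a x = vscale X (\<psi> a) x) \<longrightarrow>
        (\<forall>D. algebra_continuous_derivation A X l r D \<longrightarrow> algebra_inner A X l r D)) \<and>
     (\<forall>(X :: 'x nspace) l r. algebra_bimodule A X l r \<and>
        (\<forall>a\<in>vcarrier A. \<forall>x\<in>vcarrier X. r a x = vscale X (\<psi> a) x) \<longrightarrow>
        (\<forall>D. algebra_continuous_derivation A X l r D \<longrightarrow> algebra_inner A X l r D))"


section \<open>The semigroup algebra\<close>

definition ell1 :: "('s::semigroup_mult \<Rightarrow> complex) nalgebra" where
  "ell1 = \<lparr>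
     vcarrier = {f. (\<lambda>s. cmod (f s)) summable_on UNIV},
     vadd = (\<lambda>f g s. f s + g s),
     vzero = (\<lambda>s. 0),
     vscale = (\<lambda>c f s. c * f s),
     vnorm = (\<lambda>f. \<Sum>\<^sub>\<infinity>s. cmod (f s)),
     amult = (\<lambda>f g u. \<Sum>\<^sub>\<infinity>(s, t)\<in>{(s, t). s * t = u}. f s * g t)\<rparr>"

definition induced_character :: "('s \<Rightarrow> complex) \<Rightarrow> ('s \<Rightarrow> complex) \<Rightarrow> complex" where
  "induced_character \<phi> f = (\<Sum>\<^sub>\<infinity>s. \<phi> s * f s)"


section \<open>Well-definedness\<close>

text \<open>The norm metric is a metric in the sense of \<open>Metric_space\<close> (so \<open>norm_topology\<close> and \<open>complete\<close>
  have their intended meaning), the dual is a normed space, \<open>ell1\<close> is a Banach algebra and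
  \<open>induced_character \<phi>\<close> is a character on it.\<close>

context complex_normed_space
begin

lemma minus_closed: "\<lbrakk>x \<in> vcarrier X; y \<in> vcarrier X\<rbrakk> \<Longrightarrow> vminus X x y \<in> vcarrier X"
  by (simp add: vminus_def add_closed scale_closed)

lemma minus_eq_zero:
  assumes "x \<in> vcarrier X" "y \<in> vcarrier X"
  shows "vminus X x y = vzero X \<longleftrightarrow> x = y"
proof
  assume "vminus X x y = vzero X"
  then have "vadd X (vadd X x (vscale X (-1) y)) y = vadd X (vzero X) y"
    by (simp add: vminus_def)
  moreover have "vadd X (vadd X x (vscale X (-1) y)) y = vadd X x (vadd X y (vscale X (-1) y))"
    using assms by (simp add: add_assoc add_commute scale_closed)
  ultimately show "x = y"
    using assms minus_self[of y]
    by (metis add_commute add_zero vminus_def zero_closed)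
qed (use assms minus_self in auto)

lemma norm_minus_commute:
  assumes "x \<in> vcarrier X" "y \<in> vcarrier X"
  shows "vnorm X (vminus X x y) = vnorm X (vminus X y x)"
proof -
  have "vscale X (-1) (vminus X x y) = vminus X y x"
    using assms by (simp add: vminus_def scale_add_right scale_closed scale_scale scale_one add_commute)
  then show ?thesis
    using norm_scale[OF minus_closed[OF assms], of "-1"] by simp
qed

lemma minus_add_minus:
  assumes "x \<in> vcarrier X" "y \<in> vcarrier X" "z \<in> vcarrier X"
  shows "vadd X (vminus X x y) (vminus X y z) = vminus X x z"
proof -
  have "vadd X (vminus X x y) (vminus X y z)
      = vadd X x (vadd X (vadd X (vscale X (-1) y) y) (vscale X (-1) z))"
    using assms by (simp add: vminus_def add_assoc add_closed scale_closed)
  also have "vadd X (vscale X (-1) y) y = vzero X"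
    using assms minus_self[of y] by (simp add: vminus_def add_commute scale_closed)
  also have "vadd X (vzero X) (vscale X (-1) z) = vscale X (-1) z"
    using assms by (metis add_commute add_zero scale_closed zero_closed)
  finally show ?thesis by (simp add: vminus_def)
qed

lemma Metric_space_vdist: "Metric_space (vcarrier X) (vdist X)"
proof
  fix x y
  show "0 \<le> vdist X x y"
    by (simp add: vdist_def norm_nonneg minus_closed)
  show "vdist X x y = vdist X y x"
    using norm_minus_commute by (auto simp: vdist_def)
next
  fix x y assume "x \<in> vcarrier X" "y \<in> vcarrier X"
  then show "vdist X x y = 0 \<longleftrightarrow> x = y"
    by (simp add: vdist_def norm_eq_zero minus_closed minus_eq_zero)
next
  fix x y z assume "x \<in> vcarrier X" "y \<in> vcarrier X" "z \<in> vcarrier X"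
  then show "vdist X x z \<le> vdist X x y + vdist X y z"
    using norm_triangle[of "vminus X x y" "vminus X y z"]
    by (simp add: vdist_def minus_closed minus_add_minus)
qed

lemma norm_zero: "vnorm X (vzero X) = 0"
  using norm_eq_zero zero_closed by blast

lemma dual_bdd_above:
  assumes "f \<in> vcarrier (dual X)"
  shows "bdd_above ((\<lambda>x. cmod (f x)) ` {x \<in> vcarrier X. vnorm X x \<le> 1})"
proof -
  obtain C where C: "\<And>x. x \<in> vcarrier X \<Longrightarrow> cmod (f x) \<le> C * vnorm X x"
    using assms by (auto simp: dual_def)
  show ?thesis
  proof (rule bdd_aboveI2)
    fix x assume x: "x \<in> {x \<in> vcarrier X. vnorm X x \<le> 1}"
    have "cmod (f x) \<le> C * vnorm X x" using C x by auto
    also have "\<dots> \<le> \<bar>C\<bar> * 1" using x norm_nonneg[of x] by (intro mult_mono) auto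
    finally show "cmod (f x) \<le> \<bar>C\<bar>" by simp
  qed
qed

lemma dual_norm_upper:
  assumes "f \<in> vcarrier (dual X)" "x \<in> vcarrier X" "vnorm X x \<le> 1"
  shows "cmod (f x) \<le> vnorm (dual X) f"
  unfolding dual_def using cSUP_upper[OF _ dual_bdd_above[OF assms(1)], of x] assms by simp

lemma dual_norm_least:
  assumes "\<And>x. \<lbrakk>x \<in> vcarrier X; vnorm X x \<le> 1\<rbrakk> \<Longrightarrow> cmod (f x) \<le> C"
  shows "vnorm (dual X) f \<le> C"
proof -
  have ne: "{x \<in> vcarrier X. vnorm X x \<le> 1} \<noteq> {}"
    using zero_closed norm_zero by (auto intro!: exI[of _ "vzero X"])
  have "vnorm (dual X) f = Sup ((\<lambda>x. cmod (f x)) ` {x \<in> vcarrier X. vnorm X x \<le> 1})"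
    by (simp add: dual_def)
  also have "\<dots> \<le> C"
    by (rule cSUP_least[OF ne]) (use assms in auto)
  finally show ?thesis .
qed

lemma dual_norm_bound:
  assumes "f \<in> vcarrier (dual X)" "x \<in> vcarrier X"
  shows "cmod (f x) \<le> vnorm (dual X) f * vnorm X x"
proof (cases "x = vzero X")
  case True
  have "cmod (f x) \<le> 0" using assms True norm_zero by (auto simp: dual_def)
  then show ?thesis using True norm_zero by simp
next
  case False
  then have pos: "vnorm X x > 0" using assms norm_nonneg[of x] norm_eq_zero[of x] by fastforce
  let ?y = "vscale X (of_real (1 / vnorm X x)) x"
  have y: "?y \<in> vcarrier X" "vnorm X ?y \<le> 1"
    using assms pos by (auto simp: scale_closed norm_scale norm_divide)
  have "f ?y = of_real (1 / vnorm X x) * f x"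
    using assms by (auto simp: dual_def linear_map_def complex_space_def)
  then have "cmod (f x) / vnorm X x \<le> vnorm (dual X) f"
    using dual_norm_upper[OF assms(1) y] pos by (simp add: norm_mult norm_divide)
  then show ?thesis using pos by (simp add: field_simps)
qed

lemma complex_normed_space_dual: "complex_normed_space (dual X)"
proof -
  have sc: "vscale (dual X) c f \<in> vcarrier (dual X)" if f: "f \<in> vcarrier (dual X)" for c f
  proof -
    obtain C where C: "\<And>x. x \<in> vcarrier X \<Longrightarrow> cmod (f x) \<le> C * vnorm X x"
      using f by (auto simp: dual_def)
    have "cmod (c * f x) \<le> (cmod c * C) * vnorm X x" if "x \<in> vcarrier X" for x
      using mult_left_mono[OF C[OF that], of "cmod c"] by (simp add: norm_mult mult.assoc)
    then have "\<exists>C. \<forall>x\<in>vcarrier X. cmod (c * f x) \<le> C * vnorm X x" by blast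
    then show ?thesis using f
      by (auto simp: dual_def linear_map_def complex_space_def add_closed scale_closed algebra_simps)
  qed
  have ad: "vadd (dual X) f g \<in> vcarrier (dual X)"
    if f: "f \<in> vcarrier (dual X)" and g: "g \<in> vcarrier (dual X)" for f g
  proof -
    obtain C where C: "\<And>x. x \<in> vcarrier X \<Longrightarrow> cmod (f x) \<le> C * vnorm X x"
      using f by (auto simp: dual_def)
    obtain C' where C': "\<And>x. x \<in> vcarrier X \<Longrightarrow> cmod (g x) \<le> C' * vnorm X x"
      using g by (auto simp: dual_def)
    have "cmod (f x + g x) \<le> (C + C') * vnorm X x" if "x \<in> vcarrier X" for x
      using C[OF that] C'[OF that] norm_triangle_ineq[of "f x" "g x"] by (simp add: algebra_simps)
    then have "\<exists>C. \<forall>x\<in>vcarrier X. cmod (f x + g x) \<le> C * vnorm X x" by blast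
    then show ?thesis using f g
      by (auto simp: dual_def linear_map_def complex_space_def add_closed scale_closed algebra_simps)
  qed
  have nn: "0 \<le> vnorm (dual X) f" if "f \<in> vcarrier (dual X)" for f
    using dual_norm_upper[OF that zero_closed] norm_zero norm_ge_zero[of "f (vzero X)"] by linarith
  have le: "vnorm (dual X) (vscale (dual X) c f) \<le> cmod c * vnorm (dual X) f"
    if "f \<in> vcarrier (dual X)" for c f
  proof (rule dual_norm_least)
    fix x assume "x \<in> vcarrier X" "vnorm X x \<le> 1"
    then show "cmod (vscale (dual X) c f x) \<le> cmod c * vnorm (dual X) f"
      using dual_norm_upper[OF that, of x] by (simp add: dual_def norm_mult mult_left_mono)
  qed
  show ?thesis
  proof
    show "vzero (dual X) \<in> vcarrier (dual X)"
      by (auto simp: dual_def linear_map_def complex_space_def add_closed scale_closed intro: exI[of _ 0])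
  next
    fix f assume f: "f \<in> vcarrier (dual X)"
    show "vadd (dual X) f (vzero (dual X)) = f"
      using f by (auto simp: dual_def fun_eq_iff extensional_def)
    show "vminus (dual X) f f = vzero (dual X)"
      by (auto simp: dual_def vminus_def fun_eq_iff)
    show "vscale (dual X) 1 f = f"
      using f by (auto simp: dual_def fun_eq_iff extensional_def)
    show "vnorm (dual X) f = 0 \<longleftrightarrow> f = vzero (dual X)"
    proof
      assume "vnorm (dual X) f = 0"
      then have "f x = 0" if "x \<in> vcarrier X" for x
        using dual_norm_bound[OF f that] by simp
      then show "f = vzero (dual X)"
        using f by (auto simp: dual_def fun_eq_iff extensional_def)
    next
      assume "f = vzero (dual X)"
      then have "vnorm (dual X) f \<le> 0"
        by (intro dual_norm_least) (simp add: dual_def)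
      then show "vnorm (dual X) f = 0" using nn[OF f] by simp
    qed
    fix c
    show "vnorm (dual X) (vscale (dual X) c f) = cmod c * vnorm (dual X) f"
    proof (cases "c = 0")
      case True
      then show ?thesis using le[OF f, of c] nn[OF sc[OF f], of c] by simp
    next
      case False
      have "vscale (dual X) (1 / c) (vscale (dual X) c f) = f"
        using f False by (auto simp: dual_def fun_eq_iff extensional_def)
      then have "vnorm (dual X) f \<le> cmod (1 / c) * vnorm (dual X) (vscale (dual X) c f)"
        using le[OF sc[OF f, of c], of "1 / c"] by simp
      then show ?thesis using le[OF f, of c] False by (simp add: norm_divide field_simps)
    qed
  next
    fix f g assume fg: "f \<in> vcarrier (dual X)" "g \<in> vcarrier (dual X)"
    show "vnorm (dual X) (vadd (dual X) f g) \<le> vnorm (dual X) f + vnorm (dual X) g"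
    proof (rule dual_norm_least)
      fix x assume x: "x \<in> vcarrier X" "vnorm X x \<le> 1"
      have "cmod (f x + g x) \<le> vnorm (dual X) f + vnorm (dual X) g"
        using dual_norm_upper[OF fg(1) x] dual_norm_upper[OF fg(2) x]
          norm_triangle_ineq[of "f x" "g x"] by linarith
      then show "cmod (vadd (dual X) f g x) \<le> vnorm (dual X) f + vnorm (dual X) g"
        using x by (simp add: dual_def)
    qed
  qed (use sc ad nn in \<open>auto simp: dual_def fun_eq_iff algebra_simps\<close>)
qed

end

lemma ell1_summable: "f \<in> vcarrier ell1 \<longleftrightarrow> (\<lambda>s. cmod (f s)) summable_on UNIV"
  by (simp add: ell1_def)

lemma ell1_add_summable:
  assumes "(\<lambda>s. cmod (f s)) summable_on UNIV" "(\<lambda>s. cmod (g s)) summable_on UNIV"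
  shows "(\<lambda>s. cmod (f s + g s)) summable_on UNIV"
  by (rule Infinite_Sum.abs_summable_on_comparison_test'[OF summable_on_add[OF assms]])
     (rule norm_triangle_ineq)

lemma complex_normed_space_ell1: "complex_normed_space ell1"
proof
  fix f g :: "'a \<Rightarrow> complex"
  assume fg: "f \<in> vcarrier ell1" "g \<in> vcarrier ell1"
  then show "vadd ell1 f g \<in> vcarrier ell1"
    by (simp add: ell1_def ell1_add_summable)
  have "(\<Sum>\<^sub>\<infinity>s. cmod (f s + g s)) \<le> (\<Sum>\<^sub>\<infinity>s. cmod (f s) + cmod (g s))"
    using fg by (intro infsum_mono) (auto simp: ell1_def ell1_add_summable norm_triangle_ineq intro: summable_on_add)
  then show "vnorm ell1 (vadd ell1 f g) \<le> vnorm ell1 f + vnorm ell1 g"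
    using fg by (simp add: ell1_def infsum_add)
next
  fix f :: "'a \<Rightarrow> complex" and c
  assume f: "f \<in> vcarrier ell1"
  show "vscale ell1 c f \<in> vcarrier ell1"
    using f by (simp add: ell1_def norm_mult summable_on_cmult_right)
  show "vnorm ell1 (vscale ell1 c f) = cmod c * vnorm ell1 f"
    using f by (simp add: ell1_def norm_mult infsum_cmult_right)
  show "0 \<le> vnorm ell1 f" by (simp add: ell1_def infsum_nonneg)
  show "vnorm ell1 f = 0 \<longleftrightarrow> f = vzero ell1"
    using f by (auto simp: ell1_def fun_eq_iff dest: nonneg_infsum_le_0D[of _ UNIV, rotated 1])
qed (auto simp: ell1_def vminus_def fun_eq_iff algebra_simps)

lemma abs_summable_product_pair:
  fixes f :: "'p \<Rightarrow> complex" and g :: "'q \<Rightarrow> complex"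
  assumes f: "(\<lambda>s. cmod (f s)) summable_on UNIV" and g: "(\<lambda>t. cmod (g t)) summable_on UNIV"
  shows "(\<lambda>p. cmod (f (fst p) * g (snd p))) summable_on UNIV"
    and "(\<Sum>\<^sub>\<infinity>p. cmod (f (fst p) * g (snd p))) = (\<Sum>\<^sub>\<infinity>s. cmod (f s)) * (\<Sum>\<^sub>\<infinity>t. cmod (g t))"
    and "(\<Sum>\<^sub>\<infinity>p. f (fst p) * g (snd p)) = (\<Sum>\<^sub>\<infinity>s. f s) * (\<Sum>\<^sub>\<infinity>t. g t)"
proof -
  have "(\<lambda>p. cmod ((\<lambda>p. f (fst p) * g (snd p)) p)) summable_on (UNIV \<times> UNIV)"
    unfolding Infinite_Sum.abs_summable_on_Sigma_iff
    using f g by (auto simp: norm_mult infsum_cmult_right' abs_mult infsum_nonneg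
        intro!: summable_on_cmult_right summable_on_cmult_left)
  then show sum: "(\<lambda>p. cmod (f (fst p) * g (snd p))) summable_on UNIV" by simp
  have "(\<Sum>\<^sub>\<infinity>s. \<Sum>\<^sub>\<infinity>t. cmod (f s * g t)) = (\<Sum>\<^sub>\<infinity>p. cmod (f (fst p) * g (snd p)))"
    using infsum_Sigma_banach[of "\<lambda>p. cmod (f (fst p) * g (snd p))" UNIV "\<lambda>_. UNIV"] sum by simp
  then show "(\<Sum>\<^sub>\<infinity>p. cmod (f (fst p) * g (snd p))) = (\<Sum>\<^sub>\<infinity>s. cmod (f s)) * (\<Sum>\<^sub>\<infinity>t. cmod (g t))"
    by (simp add: norm_mult infsum_cmult_right' infsum_cmult_left')
  have "(\<Sum>\<^sub>\<infinity>s. \<Sum>\<^sub>\<infinity>t. f s * g t) = (\<Sum>\<^sub>\<infinity>p. f (fst p) * g (snd p))"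
    using infsum_Sigma_banach[of "\<lambda>p. f (fst p) * g (snd p)" UNIV "\<lambda>_. UNIV"]
      Infinite_Sum.abs_summable_summable[OF sum] by simp
  then show "(\<Sum>\<^sub>\<infinity>p. f (fst p) * g (snd p)) = (\<Sum>\<^sub>\<infinity>s. f s) * (\<Sum>\<^sub>\<infinity>t. g t)"
    by (simp add: infsum_cmult_right' infsum_cmult_left')
qed

lemma infsum_fibres:
  fixes F :: "'p \<Rightarrow> complex" and \<pi> :: "'p \<Rightarrow> 'u"
  assumes F: "(\<lambda>p. cmod (F p)) summable_on UNIV"
  shows "(\<lambda>u. cmod (\<Sum>\<^sub>\<infinity>p\<in>{p. \<pi> p = u}. F p)) summable_on UNIV"
    and "(\<Sum>\<^sub>\<infinity>u. cmod (\<Sum>\<^sub>\<infinity>p\<in>{p. \<pi> p = u}. F p)) \<le> (\<Sum>\<^sub>\<infinity>p. cmod (F p))"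
    and "(\<Sum>\<^sub>\<infinity>u. \<Sum>\<^sub>\<infinity>p\<in>{p. \<pi> p = u}. F p) = (\<Sum>\<^sub>\<infinity>p. F p)"
proof -
  let ?S = "Sigma UNIV (\<lambda>u. {p. \<pi> p = u})"
  have bij: "bij_betw snd ?S UNIV"
    by (rule bij_betwI[of _ _ _ "\<lambda>p. (\<pi> p, p)"]) auto
  have n: "(\<lambda>x. cmod (F (snd x))) summable_on ?S"
    using summable_on_reindex_bij_betw[OF bij, of "\<lambda>p. cmod (F p)"] F by simp
  then have c: "(\<lambda>x. F (snd x)) summable_on ?S"
    by (rule Infinite_Sum.abs_summable_summable)
  show "(\<Sum>\<^sub>\<infinity>u. \<Sum>\<^sub>\<infinity>p\<in>{p. \<pi> p = u}. F p) = (\<Sum>\<^sub>\<infinity>p. F p)"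
    using infsum_Sigma_banach[OF c] infsum_reindex_bij_betw[OF bij, of F] by simp
  have n2: "(\<Sum>\<^sub>\<infinity>u. \<Sum>\<^sub>\<infinity>p\<in>{p. \<pi> p = u}. cmod (F p)) = (\<Sum>\<^sub>\<infinity>p. cmod (F p))"
    using infsum_Sigma_banach[OF n] infsum_reindex_bij_betw[OF bij, of "\<lambda>p. cmod (F p)"] by simp
  have n3: "(\<lambda>u. \<Sum>\<^sub>\<infinity>p\<in>{p. \<pi> p = u}. cmod (F p)) summable_on UNIV"
    by (rule summable_on_Sigma_banach[of "\<lambda>_ p. cmod (F p)"]) (use n in \<open>simp add: case_prod_unfold\<close>)
  have le: "cmod (\<Sum>\<^sub>\<infinity>p\<in>{p. \<pi> p = u}. F p) \<le> (\<Sum>\<^sub>\<infinity>p\<in>{p. \<pi> p = u}. cmod (F p))" for u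
    by (intro norm_infsum_bound summable_on_subset_banach[OF F]) auto
  show s: "(\<lambda>u. cmod (\<Sum>\<^sub>\<infinity>p\<in>{p. \<pi> p = u}. F p)) summable_on UNIV"
    by (rule Infinite_Sum.abs_summable_on_comparison_test'[OF n3 le])
  show "(\<Sum>\<^sub>\<infinity>u. cmod (\<Sum>\<^sub>\<infinity>p\<in>{p. \<pi> p = u}. F p)) \<le> (\<Sum>\<^sub>\<infinity>p. cmod (F p))"
    unfolding n2[symmetric] by (rule infsum_mono[OF s n3 le])
qed

lemma ell1_mult_eq:
  "amult ell1 f g u = (\<Sum>\<^sub>\<infinity>p\<in>{p. fst p * snd p = u}. f (fst p) * g (snd p))"
  by (simp add: ell1_def case_prod_unfold)

lemma ell1_complete:
  "Metric_space.mcomplete (vcarrier (ell1 :: ('a::semigroup_mult \<Rightarrow> complex) nalgebra)) (vdist ell1)"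
proof -
  interpret ell1: complex_normed_space "ell1 :: ('a \<Rightarrow> complex) nalgebra" by (rule complex_normed_space_ell1)
  interpret M: Metric_space "vcarrier (ell1 :: ('a \<Rightarrow> complex) nalgebra)" "vdist ell1" by (rule ell1.Metric_space_vdist)
  have dist: "vdist ell1 f g = (\<Sum>\<^sub>\<infinity>s. cmod (f s - g s))"
    if "f \<in> vcarrier ell1" "g \<in> vcarrier ell1" for f g :: "'a \<Rightarrow> complex"
    using that by (simp add: vdist_def vminus_def ell1_def)
  have diff: "(\<lambda>s. cmod (f s - g s)) summable_on UNIV"
    if "f \<in> vcarrier ell1" "g \<in> vcarrier ell1" for f g :: "'a \<Rightarrow> complex"
    using ell1.minus_closed[OF that] by (simp add: vminus_def ell1_def)
  show ?thesis unfolding M.mcomplete_def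
  proof (intro allI impI)
    fix \<sigma> :: "nat \<Rightarrow> 'a \<Rightarrow> complex" assume \<sigma>: "M.MCauchy \<sigma>"
    then have mem: "\<sigma> n \<in> vcarrier ell1" for n
      unfolding M.MCauchy_def by auto
    have finle: "(\<Sum>s\<in>F. cmod (\<sigma> n s - \<sigma> m s)) \<le> vdist ell1 (\<sigma> n) (\<sigma> m)" if "finite F" for F n m
      unfolding dist[OF mem mem] using that by (intro finite_sum_le_infsum diff mem) auto
    have "Cauchy (\<lambda>n. \<sigma> n s)" for s
    proof (rule metric_CauchyI)
      fix e :: real assume "e > 0"
      then obtain N where N: "\<And>n n'. \<lbrakk>N \<le> n; N \<le> n'\<rbrakk> \<Longrightarrow> vdist ell1 (\<sigma> n) (\<sigma> n') < e"
        using \<sigma> unfolding M.MCauchy_def by meson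
      have "dist (\<sigma> m s) (\<sigma> n s) < e" if "m \<ge> N" "n \<ge> N" for m n
        using N[OF that] finle[of "{s}" m n] by (simp add: dist_norm)
      then show "\<exists>M. \<forall>m\<ge>M. \<forall>n\<ge>M. dist (\<sigma> m s) (\<sigma> n s) < e" by blast
    qed
    then have "\<exists>l. (\<lambda>n. \<sigma> n s) \<longlonglongrightarrow> l" for s
      using Cauchy_convergent convergent_def by blast
    then obtain g where g: "\<And>s. (\<lambda>n. \<sigma> n s) \<longlonglongrightarrow> g s" by metis
    have key: "\<exists>N. \<forall>n\<ge>N. (\<lambda>s. cmod (\<sigma> n s - g s)) summable_on UNIV \<and>
                 (\<Sum>\<^sub>\<infinity>s. cmod (\<sigma> n s - g s)) < e" if e: "e > 0" for e
    proof -
      obtain N where N: "\<And>n n'. \<lbrakk>N \<le> n; N \<le> n'\<rbrakk> \<Longrightarrow> vdist ell1 (\<sigma> n) (\<sigma> n') < e / 2"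
        using \<sigma> e unfolding M.MCauchy_def by (meson half_gt_zero)
      have "(\<lambda>s. cmod (\<sigma> n s - g s)) summable_on UNIV \<and>
                 (\<Sum>\<^sub>\<infinity>s. cmod (\<sigma> n s - g s)) < e" if n: "n \<ge> N" for n
      proof -
        have b: "(\<Sum>s\<in>F. cmod (\<sigma> n s - g s)) \<le> e / 2" if F: "finite F" for F
        proof (rule LIMSEQ_le_const2)
          show "(\<lambda>m. \<Sum>s\<in>F. cmod (\<sigma> n s - \<sigma> m s)) \<longlonglongrightarrow> (\<Sum>s\<in>F. cmod (\<sigma> n s - g s))"
            by (intro tendsto_intros g)
          show "\<exists>k. \<forall>m\<ge>k. (\<Sum>s\<in>F. cmod (\<sigma> n s - \<sigma> m s)) \<le> e / 2"
            using N[OF n] finle[OF F, of n] by (meson less_imp_le order_trans)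
        qed
        have s: "(\<lambda>s. cmod (\<sigma> n s - g s)) summable_on UNIV"
          by (rule nonneg_bdd_above_summable_on) (auto intro!: bdd_aboveI2[of _ _ "e / 2"] b)
        have "(\<Sum>\<^sub>\<infinity>s. cmod (\<sigma> n s - g s)) \<le> e / 2"
          by (rule infsum_le_finite_sums[OF s]) (use b in auto)
        then show ?thesis using s e by simp
      qed
      then show ?thesis by blast
    qed
    obtain N where "(\<lambda>s. cmod (\<sigma> N s - g s)) summable_on UNIV"
      using key[of 1] by auto
    then have "(\<lambda>s. \<sigma> N s - g s) \<in> vcarrier ell1" by (simp add: ell1_def)
    then have "vminus ell1 (\<sigma> N) (\<lambda>s. \<sigma> N s - g s) \<in> vcarrier ell1"
      by (intro ell1.minus_closed mem)
    then have gm: "g \<in> vcarrier ell1" by (simp add: vminus_def ell1_def)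
    have "limitin M.mtopology \<sigma> g sequentially"
      unfolding M.limit_metric_sequentially using gm mem key dist[OF mem gm] by metis
    then show "\<exists>x. limitin M.mtopology \<sigma> x sequentially" by blast
  qed
qed

lemma ell1_mult_closed:
  assumes "f \<in> vcarrier ell1" "g \<in> vcarrier ell1"
  shows "amult ell1 f g \<in> vcarrier ell1"
    and "vnorm ell1 (amult ell1 f g) \<le> vnorm ell1 f * vnorm ell1 g"
proof -
  note fg = assms[unfolded ell1_summable]
  note p = abs_summable_product_pair[OF fg]
  note q = infsum_fibres[OF p(1), of "\<lambda>p. fst p * snd p"]
  show "amult ell1 f g \<in> vcarrier ell1"
    unfolding ell1_summable ell1_mult_eq by (rule q(1))
  have "vnorm ell1 (amult ell1 f g) = (\<Sum>\<^sub>\<infinity>u. cmod (amult ell1 f g u))"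
    by (simp add: ell1_def)
  also have "\<dots> \<le> vnorm ell1 f * vnorm ell1 g"
    unfolding ell1_mult_eq using q(2) p(2) by (simp add: ell1_def)
  finally show "vnorm ell1 (amult ell1 f g) \<le> vnorm ell1 f * vnorm ell1 g" .
qed

lemma ell1_mult_assoc:
  fixes f g h :: "'a::semigroup_mult \<Rightarrow> complex"
  assumes "f \<in> vcarrier ell1" "g \<in> vcarrier ell1" "h \<in> vcarrier ell1"
  shows "amult ell1 (amult ell1 f g) h = amult ell1 f (amult ell1 g h)"
proof
  fix u
  note fgh = assms[unfolded ell1_summable]
  let ?K = "\<lambda>x. f (fst (fst x)) * g (snd (fst x)) * h (snd x)"
  let ?T = "{x :: ('a \<times> 'a) \<times> 'a. fst (fst x) * snd (fst x) * snd x = u}"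
  let ?S1 = "Sigma {p. fst p * snd p = u} (\<lambda>p. {q. fst q * snd q = fst p})"
  let ?S2 = "Sigma {p. fst p * snd p = u} (\<lambda>p. {q. fst q * snd q = snd p})"
  have "(\<lambda>x. cmod (?K x)) summable_on UNIV"
    using abs_summable_product_pair(1)[OF abs_summable_product_pair(1)[OF fgh(1,2)] fgh(3)] .
  then have "?K summable_on UNIV"
    by (rule Infinite_Sum.abs_summable_summable)
  then have K: "?K summable_on ?T"
    by (rule summable_on_subset_banach) simp
  have bij1: "bij_betw (\<lambda>x. (snd x, snd (fst x))) ?S1 ?T"
    by (rule bij_betwI[of _ _ _ "\<lambda>x. ((fst (fst x) * snd (fst x), snd x), fst x)"]) auto
  have bij2: "bij_betw (\<lambda>x. ((fst (fst x), fst (snd x)), snd (snd x))) ?S2 ?T"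
    by (rule bij_betwI[of _ _ _ "\<lambda>x. ((fst (fst x), snd (fst x) * snd x), (snd (fst x), snd x))"])
       (auto simp: mult.assoc)
  have K1: "(\<lambda>x. ?K (snd x, snd (fst x))) summable_on ?S1"
    using K unfolding summable_on_reindex_bij_betw[OF bij1, of ?K] .
  have K2: "(\<lambda>x. ?K ((fst (fst x), fst (snd x)), snd (snd x))) summable_on ?S2"
    using K unfolding summable_on_reindex_bij_betw[OF bij2, of ?K] .
  have "amult ell1 (amult ell1 f g) h u
      = (\<Sum>\<^sub>\<infinity>p\<in>{p. fst p * snd p = u}. \<Sum>\<^sub>\<infinity>q\<in>{q. fst q * snd q = fst p}. ?K (q, snd p))"
    by (simp add: ell1_mult_eq infsum_cmult_left')
  also have "\<dots> = infsum ?K ?T"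
    using infsum_Sigma_banach[OF K1] infsum_reindex_bij_betw[OF bij1, of ?K] by simp
  also have "\<dots> = (\<Sum>\<^sub>\<infinity>p\<in>{p. fst p * snd p = u}. \<Sum>\<^sub>\<infinity>q\<in>{q. fst q * snd q = snd p}.
                     ?K ((fst p, fst q), snd q))"
    using infsum_Sigma_banach[OF K2] infsum_reindex_bij_betw[OF bij2, of ?K] by simp
  also have "\<dots> = amult ell1 f (amult ell1 g h) u"
    by (simp add: ell1_mult_eq infsum_cmult_right' mult.assoc)
  finally show "amult ell1 (amult ell1 f g) h u = amult ell1 f (amult ell1 g h) u" .
qed

theorem complex_banach_algebra_ell1:
  "complex_banach_algebra (ell1 :: ('a::semigroup_mult \<Rightarrow> complex) nalgebra)"
proof -
  interpret ell1: complex_normed_space "ell1 :: ('a \<Rightarrow> complex) nalgebra" by (rule complex_normed_space_ell1)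
  have sm: "(\<lambda>p. f (fst p) * g (snd p)) summable_on S"
    if "f \<in> vcarrier ell1" "g \<in> vcarrier ell1" for f g :: "'a \<Rightarrow> complex" and S
    by (rule summable_on_subset_banach[OF Infinite_Sum.abs_summable_summable
          [OF abs_summable_product_pair(1)[OF that[unfolded ell1_summable]]]]) simp
  have add: "vadd ell1 f g = (\<lambda>s. f s + g s)" and scale: "vscale ell1 c f = (\<lambda>s. c * f s)"
    for f g :: "'a \<Rightarrow> complex" and c by (simp_all add: ell1_def)
  show ?thesis
  proof
    fix a :: "'a \<Rightarrow> complex"
    assume a: "a \<in> vcarrier ell1"
    show "linear_map ell1 ell1 (amult ell1 a)"
      unfolding linear_map_def
      by (auto simp: a ell1_mult_closed ell1_mult_eq fun_eq_iff add scale distrib_left sm infsum_add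
          infsum_cmult_right'[symmetric] mult.left_commute)
    show "linear_map ell1 ell1 (\<lambda>f. amult ell1 f a)"
      unfolding linear_map_def
      by (auto simp: a ell1_mult_closed ell1_mult_eq fun_eq_iff add scale distrib_right sm infsum_add
          infsum_cmult_right'[symmetric] mult.assoc)
  qed (use ell1_complete ell1_mult_assoc ell1_mult_closed in auto)
qed

theorem algebra_character_induced_character:
  assumes \<phi>: "\<phi> \<in> semigroup_characters"
  shows "algebra_character ell1 (induced_character \<phi>)"
proof -
  have norm_phi [simp]: "cmod (\<phi> s) = 1" and mult: "\<phi> (s * t) = \<phi> s * \<phi> t" for s t
    using \<phi> by (auto simp: semigroup_characters_def)
  have n: "(\<lambda>s. cmod (\<phi> s * f s)) summable_on UNIV" if "f \<in> vcarrier ell1" for f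
    using that by (simp add: norm_mult ell1_def)
  have s: "(\<lambda>s. \<phi> s * f s) summable_on UNIV" if "f \<in> vcarrier ell1" for f
    by (rule Infinite_Sum.abs_summable_summable[OF n[OF that]])
  have lin: "linear_map ell1 complex_space (induced_character \<phi>)"
    unfolding linear_map_def complex_space_def induced_character_def
    using s by (auto simp: ell1_def distrib_left infsum_add infsum_cmult_right'[symmetric] mult.left_commute)
  have mul: "induced_character \<phi> (amult ell1 f g) = induced_character \<phi> f * induced_character \<phi> g"
    if fg: "f \<in> vcarrier ell1" "g \<in> vcarrier ell1" for f g
  proof -
    let ?F = "\<lambda>p. (\<phi> (fst p) * f (fst p)) * (\<phi> (snd p) * g (snd p))"
    note p = abs_summable_product_pair[OF n[OF fg(1)] n[OF fg(2)]]
    have "\<phi> u * amult ell1 f g u = (\<Sum>\<^sub>\<infinity>p\<in>{p. fst p * snd p = u}. ?F p)" for u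
      unfolding ell1_mult_eq infsum_cmult_right'[symmetric]
      by (rule infsum_cong) (auto simp: mult)
    then have "induced_character \<phi> (amult ell1 f g) = (\<Sum>\<^sub>\<infinity>p. ?F p)"
      using infsum_fibres(3)[OF p(1), of "\<lambda>p. fst p * snd p"]
      by (simp add: induced_character_def)
    then show ?thesis using p(3) by (simp add: induced_character_def)
  qed
  define \<delta> :: "'a \<Rightarrow> complex" where "\<delta> = (\<lambda>s. if s = undefined then 1 else 0)"
  have "(\<lambda>s. cmod (\<delta> s)) summable_on UNIV"
    using summable_on_cong_neutral[of "{undefined}" UNIV "\<lambda>s. cmod (\<delta> s)" "\<lambda>s. cmod (\<delta> s)"]
    by (simp add: \<delta>_def)
  moreover have "induced_character \<phi> \<delta> = \<phi> undefined"
    using infsum_cong_neutral[of "{undefined}" UNIV "\<lambda>s. \<phi> s * \<delta> s" "\<lambda>s. \<phi> s * \<delta> s"]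
    by (simp add: \<delta>_def induced_character_def)
  moreover have "\<phi> undefined \<noteq> 0"
    using norm_phi[of undefined] by (metis norm_zero zero_neq_one)
  ultimately have "\<exists>f\<in>vcarrier ell1. induced_character \<phi> f \<noteq> 0"
    by (auto simp: ell1_def)
  then show ?thesis using lin mul by (auto simp: algebra_character_def)
qed

end

theory Submission
  imports Defs "HOL-Algebra.FiniteProduct"
begin

text \<open>
  The algebra $\ell^1(S)$ is the free Banach space on $S$: a bounded family \<open>v\<close> indexed by $S$ in a
  Banach space $Y$ extends to exactly one bounded linear map $T : \ell^1(S) \to Y$ with
  $T(\delta_s) = v_s$, namely $T(a) = \sum_s a(s) v_s$. Existence is \<open>ell1_universal\<close>, uniqueness is
  \<open>ell1_bounded_linear_eqI\<close>. Since $\delta_s * \delta_t = \delta_{st}$, every piece of structure over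
  $S$ on a Banach space $X$ corresponds to one over $\ell^1(S)$ on the same space $X$, and so
  neither direction of the equivalence leaves the type from which the elements of $X$ are drawn.

  From $\ell^1(S)$ to $S$ one restricts the two actions and the derivation to point masses
  (\<open>ell1_derivation_restricts\<close>); the results are uniformly bounded because $\|\delta_s\| = 1$. From $S$ to
  $\ell^1(S)$ one extends the actions on $X$, and the derivation regarded as a family of maps
  $X \to \mathbb{C}$, by the universal property (\<open>semigroup_derivation_extends\<close>). The module laws,
  the derivation identity, the condition that an action is scalar through the character, and the
  formula expressing that the derivation is inner are all equations between bounded linear or bilinear
  maps on $\ell^1(S)$. Hence each of them holds everywhere as soon as it holds on point
  masses, where it is the corresponding equation over $S$. Principal derivations therefore match
  inner ones, with the same implementing functional $f \in X^*$.
\<close>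

section \<open>Bounded linear maps between spaces with explicit carriers\<close>

context complex_normed_space
begin

lemma scale_zero:
  assumes "x \<in> vcarrier X"
  shows "vscale X 0 x = vzero X"
  using norm_scale[OF assms, of 0] norm_eq_zero[OF scale_closed[OF assms]] by simp

lemma zero_add: "x \<in> vcarrier X \<Longrightarrow> vadd X (vzero X) x = x"
  using add_commute add_zero zero_closed by metis

lemma add_left_commute:
  "\<lbrakk>x \<in> vcarrier X; y \<in> vcarrier X; z \<in> vcarrier X\<rbrakk>
    \<Longrightarrow> vadd X x (vadd X y z) = vadd X y (vadd X x z)"
  by (metis add_assoc add_commute)

lemmas add_ac = add_assoc add_commute add_left_commute

lemma scale_vzero: "vscale X c (vzero X) = vzero X"
  using scale_zero[OF zero_closed] scale_scale[OF zero_closed, of c 0] by simp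

lemma vdist_zero_right: "x \<in> vcarrier X \<Longrightarrow> vdist X x (vzero X) = vnorm X x"
  by (simp add: vdist_def vminus_def zero_closed scale_vzero add_zero)

lemma vdist_nonneg: "0 \<le> vdist X x y"
  using Metric_space.nonneg[OF Metric_space_vdist] .

lemma vdist_commute: "vdist X x y = vdist X y x"
  using Metric_space.commute[OF Metric_space_vdist] .

lemma vdist_triangle:
  "\<lbrakk>x \<in> vcarrier X; y \<in> vcarrier X; z \<in> vcarrier X\<rbrakk> \<Longrightarrow> vdist X x z \<le> vdist X x y + vdist X y z"
  using Metric_space.triangle[OF Metric_space_vdist] .

lemma vdist_le_zeroD: "\<lbrakk>x \<in> vcarrier X; y \<in> vcarrier X; vdist X x y \<le> 0\<rbrakk> \<Longrightarrow> x = y"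
  using Metric_space.zero[OF Metric_space_vdist] vdist_nonneg by (metis order_antisym)

lemma vdist_add:
  assumes "x \<in> vcarrier X" "y \<in> vcarrier X" "x' \<in> vcarrier X" "y' \<in> vcarrier X"
  shows "vdist X (vadd X x y) (vadd X x' y') \<le> vdist X x x' + vdist X y y'"
proof -
  have "vminus X (vadd X x y) (vadd X x' y') = vadd X (vminus X x x') (vminus X y y')"
    using assms by (simp add: vminus_def scale_add_right add_closed scale_closed add_ac)
  then show ?thesis
    using assms norm_triangle[of "vminus X x x'" "vminus X y y'"]
    by (simp add: vdist_def add_closed minus_closed)
qed

lemma vdist_scale:
  assumes "x \<in> vcarrier X" "y \<in> vcarrier X"
  shows "vdist X (vscale X c x) (vscale X c y) = cmod c * vdist X x y"
proof -
  have "vminus X (vscale X c x) (vscale X c y) = vscale X c (vminus X x y)"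
    using assms by (simp add: vminus_def scale_add_right scale_closed scale_scale)
  then show ?thesis
    using assms by (simp add: vdist_def scale_closed minus_closed norm_scale)
qed

end

definition bounded_linear_map ::
    "('x, 'm) nspace_scheme \<Rightarrow> ('y, 'n) nspace_scheme \<Rightarrow> ('x \<Rightarrow> 'y) \<Rightarrow> bool" where
  "bounded_linear_map X Y T \<longleftrightarrow>
     linear_map X Y T \<and> (\<exists>C. \<forall>x\<in>vcarrier X. vnorm Y (T x) \<le> C * vnorm X x)"

lemma linear_mapD:
  assumes "linear_map X Y T"
  shows "x \<in> vcarrier X \<Longrightarrow> T x \<in> vcarrier Y"
    and "\<lbrakk>x \<in> vcarrier X; y \<in> vcarrier X\<rbrakk> \<Longrightarrow> T (vadd X x y) = vadd Y (T x) (T y)"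
    and "x \<in> vcarrier X \<Longrightarrow> T (vscale X c x) = vscale Y c (T x)"
  using assms by (auto simp: linear_map_def)

lemma bounded_linear_mapD:
  assumes "bounded_linear_map X Y T"
  shows "linear_map X Y T" "x \<in> vcarrier X \<Longrightarrow> T x \<in> vcarrier Y"
  using assms by (auto simp: bounded_linear_map_def linear_map_def)

lemma (in complex_normed_space) bounded_linear_map_pos_bound:
  assumes "bounded_linear_map X Y T"
  obtains C where "0 \<le> C" "\<And>x. x \<in> vcarrier X \<Longrightarrow> vnorm Y (T x) \<le> C * vnorm X x"
proof -
  obtain C where C: "\<And>x. x \<in> vcarrier X \<Longrightarrow> vnorm Y (T x) \<le> C * vnorm X x"
    using assms by (auto simp: bounded_linear_map_def)
  have "vnorm Y (T x) \<le> \<bar>C\<bar> * vnorm X x" if "x \<in> vcarrier X" for x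
    using C[OF that] mult_right_mono[OF abs_ge_self[of C] norm_nonneg[OF that]] by linarith
  then show ?thesis using that[of "\<bar>C\<bar>"] by simp
qed

lemma vdist_linear_map:
  assumes "complex_normed_space X" "linear_map X Y T"
    and "\<And>x. x \<in> vcarrier X \<Longrightarrow> vnorm Y (T x) \<le> C * vnorm X x"
    and "x \<in> vcarrier X" "y \<in> vcarrier X"
  shows "vdist Y (T x) (T y) \<le> C * vdist X x y"
proof -
  interpret complex_normed_space X by fact
  have "vminus Y (T x) (T y) = T (vminus X x y)"
    using assms by (simp add: vminus_def linear_mapD[OF assms(2)] scale_closed)
  then show ?thesis
    using assms by (simp add: vdist_def linear_mapD[OF assms(2)] minus_closed)
qed

lemma bounded_linear_map_compose:
  assumes X: "complex_normed_space X" and Y: "complex_normed_space Y"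
    and T: "bounded_linear_map X Y T" and U: "bounded_linear_map Y Z U"
  shows "bounded_linear_map X Z (\<lambda>x. U (T x))"
proof -
  obtain C where C: "0 \<le> C" "\<And>x. x \<in> vcarrier X \<Longrightarrow> vnorm Y (T x) \<le> C * vnorm X x"
    using complex_normed_space.bounded_linear_map_pos_bound[OF X T] by blast
  obtain K where K: "0 \<le> K" "\<And>y. y \<in> vcarrier Y \<Longrightarrow> vnorm Z (U y) \<le> K * vnorm Y y"
    using complex_normed_space.bounded_linear_map_pos_bound[OF Y U] by blast
  have "vnorm Z (U (T x)) \<le> (K * C) * vnorm X x" if "x \<in> vcarrier X" for x
    using K(2)[of "T x"] mult_left_mono[OF C(2)[OF that] K(1)] bounded_linear_mapD(2)[OF T that]
    by (simp add: mult.assoc)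
  then show ?thesis
    using bounded_linear_mapD(1)[OF T] bounded_linear_mapD(1)[OF U]
    by (auto simp: bounded_linear_map_def linear_map_def)
qed

lemma bounded_linear_map_add:
  assumes X: "complex_normed_space X" and Y: "complex_normed_space Y"
    and T: "bounded_linear_map X Y T" and U: "bounded_linear_map X Y U"
  shows "bounded_linear_map X Y (\<lambda>x. vadd Y (T x) (U x))"
proof -
  interpret Y: complex_normed_space Y by fact
  obtain C where C: "0 \<le> C" "\<And>x. x \<in> vcarrier X \<Longrightarrow> vnorm Y (T x) \<le> C * vnorm X x"
    using complex_normed_space.bounded_linear_map_pos_bound[OF X T] by blast
  obtain K where K: "0 \<le> K" "\<And>x. x \<in> vcarrier X \<Longrightarrow> vnorm Y (U x) \<le> K * vnorm X x"
    using complex_normed_space.bounded_linear_map_pos_bound[OF X U] by blast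
  note TU = bounded_linear_mapD(1)[OF T] bounded_linear_mapD(1)[OF U]
  have "vnorm Y (vadd Y (T x) (U x)) \<le> (C + K) * vnorm X x" if "x \<in> vcarrier X" for x
    using C(2)[OF that] K(2)[OF that]
      Y.norm_triangle[OF linear_mapD(1)[OF TU(1) that] linear_mapD(1)[OF TU(2) that]]
    by (simp add: algebra_simps)
  moreover have "linear_map X Y (\<lambda>x. vadd Y (T x) (U x))"
    unfolding linear_map_def
    using linear_mapD[OF TU(1)] linear_mapD[OF TU(2)]
    by (auto simp: Y.add_closed Y.scale_add_right Y.add_ac)
  ultimately show ?thesis by (auto simp: bounded_linear_map_def)
qed

lemma bounded_linear_map_scale:
  assumes X: "complex_normed_space X" and Y: "complex_normed_space Y"
    and T: "bounded_linear_map X Y T"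
  shows "bounded_linear_map X Y (\<lambda>x. vscale Y c (T x))"
proof (rule bounded_linear_map_compose[OF X Y T])
  interpret Y: complex_normed_space Y by fact
  show "bounded_linear_map Y Y (vscale Y c)"
    unfolding bounded_linear_map_def linear_map_def
    by (auto simp: Y.scale_closed Y.scale_add_right Y.scale_scale Y.norm_scale mult.commute)
qed

text \<open>
  Derivations on the algebra are only assumed continuous, whereas those on the semigroup carry a
  uniform bound; this translates between the two. The converse direction is the usual rescaling
  into a ball around zero on which the map stays bounded.
\<close>

lemma continuous_map_iff_bounded:
  assumes X: "complex_normed_space X" and Y: "complex_normed_space Y" and T: "linear_map X Y T"
  shows "continuous_map (norm_topology X) (norm_topology Y) T \<longleftrightarrow> bounded_linear_map X Y T"
proof -
  interpret X: complex_normed_space X by fact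
  interpret Y: complex_normed_space Y by fact
  interpret M: Metric_space "vcarrier X" "vdist X" by (rule X.Metric_space_vdist)
  have cont: "continuous_map (norm_topology X) (norm_topology Y) T \<longleftrightarrow>
      (\<forall>a\<in>vcarrier X. \<forall>e>0. \<exists>d>0. \<forall>x. x \<in> vcarrier X \<and> vdist X a x < d \<longrightarrow> vdist Y (T a) (T x) < e)"
    unfolding norm_topology_def M.metric_continuous_map[OF Y.Metric_space_vdist]
    using linear_mapD(1)[OF T] by blast
  have T0: "T (vzero X) = vzero Y"
    using linear_mapD[OF T, of "vzero X"] X.scale_zero[OF X.zero_closed] Y.scale_zero X.zero_closed
    by metis
  show ?thesis
  proof
    assume "bounded_linear_map X Y T"
    then obtain C where C: "0 \<le> C" "\<And>x. x \<in> vcarrier X \<Longrightarrow> vnorm Y (T x) \<le> C * vnorm X x"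
      using X.bounded_linear_map_pos_bound by blast
    have "vdist Y (T a) (T x) < e"
      if "a \<in> vcarrier X" "x \<in> vcarrier X" "vdist X a x < e / (C + 1)" "e > 0" for a x e
    proof -
      have "vdist Y (T a) (T x) \<le> C * vdist X a x"
        by (rule vdist_linear_map[OF X T C(2) that(1,2)])
      also have "\<dots> \<le> (C + 1) * vdist X a x"
        using X.vdist_nonneg by (intro mult_right_mono) auto
      also have "\<dots> < e"
        using that(3) C(1) by (simp add: field_simps)
      finally show ?thesis .
    qed
    then show "continuous_map (norm_topology X) (norm_topology Y) T"
      unfolding cont using C(1)
      by (metis add_nonneg_pos divide_pos_pos zero_less_one)
  next
    assume "continuous_map (norm_topology X) (norm_topology Y) T"
    then obtain d where d: "d > 0"
      "\<And>x. \<lbrakk>x \<in> vcarrier X; vdist X (vzero X) x < d\<rbrakk> \<Longrightarrow> vdist Y (T (vzero X)) (T x) < 1"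
      unfolding cont using X.zero_closed zero_less_one by metis
    have small: "vnorm Y (T x) < 1" if "x \<in> vcarrier X" "vnorm X x < d" for x
      using d(2)[OF that(1)] that linear_mapD(1)[OF T that(1)] T0
      by (simp add: X.vdist_commute[of "vzero X"] Y.vdist_commute[of "vzero Y"]
          X.vdist_zero_right Y.vdist_zero_right)
    have "vnorm Y (T x) \<le> (2 / d) * vnorm X x" if x: "x \<in> vcarrier X" for x
    proof (cases "x = vzero X")
      case True
      then show ?thesis using T0 X.norm_zero Y.norm_zero by simp
    next
      case False
      then have pos: "vnorm X x > 0" using X.norm_nonneg[OF x] X.norm_eq_zero[OF x] by linarith
      \<comment> \<open>Rescale \<open>x\<close> to norm \<open>d / 2\<close>, inside the ball on which \<open>T\<close> stays below 1.\<close>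
      let ?c = "complex_of_real (d / (2 * vnorm X x))"
      have c: "cmod ?c = d / (2 * vnorm X x)" using pos d(1) by (simp add: norm_divide norm_mult)
      have "vnorm X (vscale X ?c x) < d"
        using pos d(1) x c by (simp only: X.norm_scale) simp
      then have "vnorm Y (vscale Y ?c (T x)) < 1"
        using small[of "vscale X ?c x"] x linear_mapD(3)[OF T x] by (simp add: X.scale_closed)
      then have "d / (2 * vnorm X x) * vnorm Y (T x) < 1"
        using Y.norm_scale[OF linear_mapD(1)[OF T x], of ?c] c by simp
      then show ?thesis using pos d(1) by (simp add: field_simps)
    qed
    then show "bounded_linear_map X Y T" using T unfolding bounded_linear_map_def by blast
  qed
qed

lemma complex_banach_space_complex: "complex_banach_space complex_space"
proof -
  have n: "complex_normed_space complex_space"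
    by standard (auto simp: complex_space_def vminus_def algebra_simps norm_triangle_ineq norm_mult)
  have "vdist complex_space = dist"
    by (auto simp: fun_eq_iff vdist_def complex_space_def vminus_def dist_norm)
  then have "Metric_space.mcomplete (vcarrier complex_space) (vdist complex_space)"
    using mcomplete_iff_complete[where 'a = complex] complete_UNIV by (simp add: complex_space_def)
  then show ?thesis
    using n by (simp add: complex_banach_space_def complex_banach_space_axioms_def)
qed

lemma complex_normed_space_complex: "complex_normed_space complex_space"
  using complex_banach_space_complex by (simp add: complex_banach_space_def)

text \<open>
  Evaluation turns identities in the dual of \<open>X\<close> into scalar identities, one for each point of \<open>X\<close>.
\<close>

lemma bounded_linear_map_dual_eval:
  assumes X: "complex_normed_space X" and x: "x \<in> vcarrier X"
  shows "bounded_linear_map (dual X) complex_space (\<lambda>f. f x)"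
proof -
  have "cmod (f x) \<le> vnorm X x * vnorm (dual X) f" if "f \<in> vcarrier (dual X)" for f
    using complex_normed_space.dual_norm_bound[OF X that x] by (simp add: mult.commute)
  then show ?thesis
    using x by (auto simp: bounded_linear_map_def linear_map_def complex_space_def dual_def)
qed

lemma dual_bounded_linear_map:
  "f \<in> vcarrier (dual X) \<Longrightarrow> bounded_linear_map X complex_space f"
  by (auto simp: dual_def bounded_linear_map_def complex_space_def)

section \<open>Point masses\<close>

definition point_mass :: "'s \<Rightarrow> 's \<Rightarrow> complex" where
  "point_mass s = (\<lambda>t. if t = s then 1 else 0)"

lemma
  shows point_mass_closed: "point_mass s \<in> vcarrier ell1"
    and norm_point_mass: "vnorm ell1 (point_mass s) = 1"
proof -
  have e: "(\<lambda>t. cmod (point_mass s t)) = (\<lambda>t. if t = s then 1 else 0)"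
    by (auto simp: point_mass_def)
  have "((\<lambda>t. if t = s then 1 else (0::real)) has_sum 1) UNIV"
    using has_sum_finite_neutralI[of "{s}" UNIV "\<lambda>t. if t = s then 1 else (0::real)"] by simp
  then show "point_mass s \<in> vcarrier ell1" "vnorm ell1 (point_mass s) = 1"
    unfolding ell1_summable using e by (auto simp: ell1_def summable_on_def infsumI)
qed

lemma point_mass_mult: "amult ell1 (point_mass s) (point_mass t) = point_mass (s * t)"
proof
  fix u
  have "amult ell1 (point_mass s) (point_mass t) u
      = (\<Sum>\<^sub>\<infinity>p\<in>{p. fst p * snd p = u}. if p = (s, t) then 1 else 0)"
    unfolding ell1_mult_eq by (rule infsum_cong) (auto simp: point_mass_def)
  also have "\<dots> = (\<Sum>\<^sub>\<infinity>p\<in>{p. fst p * snd p = u \<and> p = (s, t)}. 1)"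
    by (rule infsum_cong_neutral) auto
  also have "\<dots> = point_mass (s * t) u"
  proof (cases "u = s * t")
    case True
    then have "{p. fst p * snd p = u \<and> p = (s, t)} = {(s, t)}" by auto
    then show ?thesis using True by (simp add: point_mass_def)
  next
    case False
    then have "{p. fst p * snd p = u \<and> p = (s, t)} = {}" by auto
    then show ?thesis using False by (simp only: infsum_empty) (simp add: point_mass_def)
  qed
  finally show "amult ell1 (point_mass s) (point_mass t) u = point_mass (s * t) u" .
qed

lemma induced_character_point_mass: "induced_character \<phi> (point_mass s) = \<phi> s"
proof -
  have "induced_character \<phi> (point_mass s) = (\<Sum>\<^sub>\<infinity>t\<in>{s}. \<phi> t * point_mass s t)"
    unfolding induced_character_def by (rule infsum_cong_neutral) (auto simp: point_mass_def)
  then show ?thesis by (simp add: point_mass_def)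
qed

lemma bounded_linear_map_induced_character:
  assumes "\<phi> \<in> semigroup_characters"
  shows "bounded_linear_map ell1 complex_space (induced_character \<phi>)"
proof -
  have 1: "cmod (\<phi> s) = 1" for s using assms by (auto simp: semigroup_characters_def)
  have "cmod (induced_character \<phi> f) \<le> 1 * vnorm ell1 f" if "f \<in> vcarrier ell1" for f
    using norm_infsum_bound[of "\<lambda>s. \<phi> s * f s" UNIV] that 1
    by (simp add: induced_character_def ell1_def norm_mult)
  then have "\<exists>C. \<forall>f\<in>vcarrier ell1. vnorm complex_space (induced_character \<phi> f) \<le> C * vnorm ell1 f"
    unfolding complex_space_def by (intro exI[of _ 1]) simp
  then show ?thesis
    using algebra_character_induced_character[OF assms]
    by (simp add: bounded_linear_map_def algebra_character_def)
qed


section \<open>The universal property of the semigroup algebra\<close>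

text \<open>
  For finite \<open>F\<close>, the number \<open>ell1_tail a F\<close> is the $\ell^1$-norm of the part of \<open>a\<close> outside \<open>F\<close>. All
  limits below are controlled by such tails.
\<close>

definition ell1_tail :: "('s \<Rightarrow> complex) \<Rightarrow> 's set \<Rightarrow> real" where
  "ell1_tail a F = (\<Sum>\<^sub>\<infinity>s. cmod (a s)) - (\<Sum>s\<in>F. cmod (a s))"

lemma ell1_tail_tendsto:
  assumes "a \<in> vcarrier ell1"
  shows "(ell1_tail a \<longlongrightarrow> 0) (finite_subsets_at_top UNIV)"
proof -
  have "((\<lambda>F. (\<Sum>\<^sub>\<infinity>s. cmod (a s)) - (\<Sum>s\<in>F. cmod (a s)))
      \<longlongrightarrow> (\<Sum>\<^sub>\<infinity>s. cmod (a s)) - (\<Sum>\<^sub>\<infinity>s. cmod (a s))) (finite_subsets_at_top UNIV)"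
    by (intro tendsto_diff tendsto_const infsum_tendsto) (use assms in \<open>simp add: ell1_summable\<close>)
  then show ?thesis by (simp add: ell1_tail_def[abs_def])
qed

lemma sum_le_ell1_tail:
  assumes "a \<in> vcarrier ell1" "finite F" "finite G" "F \<inter> G = {}"
  shows "(\<Sum>s\<in>G. cmod (a s)) \<le> ell1_tail a F"
proof -
  have "(\<Sum>s\<in>F \<union> G. cmod (a s)) \<le> (\<Sum>\<^sub>\<infinity>s. cmod (a s))"
    using assms by (intro finite_sum_le_infsum) (auto simp: ell1_summable)
  then show ?thesis using assms by (simp add: ell1_tail_def sum.union_disjoint)
qed

lemma nonpos_if_le_vanishing:
  fixes d :: real
  assumes "\<And>F. finite F \<Longrightarrow> d \<le> g F" and "(g \<longlongrightarrow> 0) (finite_subsets_at_top UNIV)"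
  shows "d \<le> 0"
  using assms(2)
  by (rule tendsto_lowerbound) (auto intro: eventually_finite_subsets_at_top_weakI assms(1))

lemma
  assumes a: "a \<in> vcarrier ell1" and F: "finite F"
  shows ell1_restrict_closed: "(\<lambda>s. if s \<in> F then a s else 0) \<in> vcarrier ell1"
    and vdist_ell1_restrict: "vdist ell1 a (\<lambda>s. if s \<in> F then a s else 0) = ell1_tail a F"
proof -
  have f: "((\<lambda>s. cmod (if s \<in> F then a s else 0)) has_sum (\<Sum>s\<in>F. cmod (a s))) UNIV"
    by (rule has_sum_finite_neutralI[OF F]) auto
  then show c: "(\<lambda>s. if s \<in> F then a s else 0) \<in> vcarrier ell1"
    by (auto simp: ell1_summable summable_on_def)
  have "(\<lambda>s. cmod (a s)) summable_on UNIV" using a by (simp add: ell1_summable)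
  then have "((\<lambda>s. cmod (a s) + - cmod (if s \<in> F then a s else 0))
      has_sum ((\<Sum>\<^sub>\<infinity>s. cmod (a s)) + - (\<Sum>s\<in>F. cmod (a s)))) UNIV"
    by (intro has_sum_add) (use f in \<open>auto simp: has_sum_uminus\<close>)
  moreover have "(\<lambda>s. cmod (a s) + - cmod (if s \<in> F then a s else 0))
      = (\<lambda>s. cmod (a s + - (if s \<in> F then a s else 0)))" by auto
  ultimately have "(\<Sum>\<^sub>\<infinity>s. cmod (a s + - (if s \<in> F then a s else 0))) = ell1_tail a F"
    by (simp add: infsumI ell1_tail_def)
  then show "vdist ell1 a (\<lambda>s. if s \<in> F then a s else 0) = ell1_tail a F"
    using a c by (simp add: vdist_def vminus_def) (simp add: ell1_def)
qed

text \<open>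
  The two maps agree on finitely supported functions by linearity, and these are dense: cutting \<open>a\<close>
  off outside a finite set \<open>F\<close> changes it by a function of norm \<open>ell1_tail a F\<close>.
\<close>

lemma ell1_bounded_linear_eqI:
  assumes Y: "complex_normed_space Y"
    and T: "bounded_linear_map ell1 Y T" and U: "bounded_linear_map ell1 Y U"
    and eq: "\<And>s. T (point_mass s) = U (point_mass s)" and a: "a \<in> vcarrier ell1"
  shows "T a = U a"
proof -
  interpret Y: complex_normed_space Y by fact
  interpret ell1: complex_normed_space ell1 by (rule complex_normed_space_ell1)
  let ?r = "\<lambda>F s. if s \<in> F then a s else 0"
  obtain C where C: "0 \<le> C" "\<And>x. x \<in> vcarrier ell1 \<Longrightarrow> vnorm Y (T x) \<le> C * vnorm ell1 x"
    using ell1.bounded_linear_map_pos_bound[OF T] by blast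
  obtain K where K: "0 \<le> K" "\<And>x. x \<in> vcarrier ell1 \<Longrightarrow> vnorm Y (U x) \<le> K * vnorm ell1 x"
    using ell1.bounded_linear_map_pos_bound[OF U] by blast
  note T = bounded_linear_mapD[OF T] and U = bounded_linear_mapD[OF U]
  have r: "T (?r F) = U (?r F)" if "finite F" for F
    using that
  proof induction
    case empty
    have z: "?r {} = vscale ell1 0 a" by (simp add: ell1_def)
    show ?case unfolding z using linear_mapD(3)[OF T(1) a] linear_mapD(3)[OF U(1) a]
        Y.scale_zero[OF T(2)[OF a]] Y.scale_zero[OF U(2)[OF a]] by simp
  next
    case (insert s F)
    have "?r (insert s F) = vadd ell1 (vscale ell1 (a s) (point_mass s)) (?r F)"
      using insert.hyps by (auto simp: ell1_def point_mass_def)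
    then show ?case
      using insert linear_mapD[OF T(1)] linear_mapD[OF U(1)]
      by (simp add: point_mass_closed ell1.scale_closed ell1_restrict_closed[OF a] eq)
  qed
  have "vdist Y (T a) (U a) \<le> (C + K) * ell1_tail a F" if F: "finite F" for F
  proof -
    note c = ell1_restrict_closed[OF a F]
    have "vdist Y (T a) (U a) \<le> vdist Y (T a) (T (?r F)) + vdist Y (U (?r F)) (U a)"
      using Y.vdist_triangle[OF T(2)[OF a] T(2)[OF c] U(2)[OF a]] r[OF F] by simp
    also have "\<dots> \<le> C * vdist ell1 a (?r F) + K * vdist ell1 (?r F) a"
      by (intro add_mono vdist_linear_map[OF ell1.complex_normed_space_axioms T(1) C(2)]
          vdist_linear_map[OF ell1.complex_normed_space_axioms U(1) K(2)] a c)
    finally show ?thesis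
      using vdist_ell1_restrict[OF a F] ell1.vdist_commute[of "?r F" a] by (simp add: algebra_simps)
  qed
  then have "vdist Y (T a) (U a) \<le> 0"
    by (rule nonpos_if_le_vanishing[where g = "\<lambda>F. (C + K) * ell1_tail a F"])
      (assumption | intro tendsto_mult_right_zero ell1_tail_tendsto a)+
  then show ?thesis using T(2)[OF a] U(2)[OF a] Y.vdist_le_zeroD by blast
qed

text \<open>
  Separate boundedness is enough, because \<open>ell1_bounded_linear_eqI\<close> can be applied in one variable
  at a time.
\<close>

lemma ell1_bilinear_eqI:
  assumes Y: "complex_normed_space Y"
    and "\<And>b. b \<in> vcarrier ell1 \<Longrightarrow> bounded_linear_map ell1 Y (\<lambda>a. B a b)"
    and "\<And>a. a \<in> vcarrier ell1 \<Longrightarrow> bounded_linear_map ell1 Y (B a)"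
    and "\<And>b. b \<in> vcarrier ell1 \<Longrightarrow> bounded_linear_map ell1 Y (\<lambda>a. B' a b)"
    and "\<And>a. a \<in> vcarrier ell1 \<Longrightarrow> bounded_linear_map ell1 Y (B' a)"
    and "\<And>s t. B (point_mass s) (point_mass t) = B' (point_mass s) (point_mass t)"
    and "a \<in> vcarrier ell1" "b \<in> vcarrier ell1"
  shows "B a b = B' a b"
proof -
  have "B (point_mass s) b = B' (point_mass s) b" for s
    by (rule ell1_bounded_linear_eqI[OF Y assms(3) assms(5) _ assms(8)])
      (use assms(6) point_mass_closed in auto)
  then show ?thesis
    by (rule ell1_bounded_linear_eqI[OF Y assms(2)[OF assms(8)] assms(4)[OF assms(8)] _ assms(7)])
qed

text \<open>
  The addition of a space with an explicit carrier is not a type class operation. Viewing it as a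
  commutative monoid with carrier gives access to finite sums over sets as \<open>finprod\<close>.
\<close>

definition additive_monoid :: "('x, 'm) nspace_scheme \<Rightarrow> 'x monoid" where
  "additive_monoid X = \<lparr>carrier = vcarrier X, monoid.mult = vadd X, one = vzero X\<rparr>"

definition combination ::
    "('x, 'm) nspace_scheme \<Rightarrow> ('s \<Rightarrow> 'x) \<Rightarrow> ('s \<Rightarrow> complex) \<Rightarrow> 's set \<Rightarrow> 'x" where
  "combination X v a F = finprod (additive_monoid X) (\<lambda>s. vscale X (a s) (v s)) F"

context complex_normed_space
begin

lemma comm_monoid_additive_monoid: "comm_monoid (additive_monoid X)"
  by (rule comm_monoidI)
    (auto simp: additive_monoid_def add_closed zero_closed add_zero zero_add add_ac)

context
  fixes v :: "'s::semigroup_mult \<Rightarrow> 'x"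
  assumes v: "\<And>s. v s \<in> vcarrier X"
begin

interpretation additive: comm_monoid "additive_monoid X"
  by (rule comm_monoid_additive_monoid)

lemma combination_closed: "combination X v a F \<in> vcarrier X"
  using additive.finprod_closed[of "\<lambda>s. vscale X (a s) (v s)" F] v
  by (auto simp: combination_def additive_monoid_def scale_closed)

lemma combination_empty: "combination X v a {} = vzero X"
  by (simp add: combination_def) (simp add: additive_monoid_def)

lemma combination_insert:
  assumes "finite F" "s \<notin> F"
  shows "combination X v a (insert s F) = vadd X (vscale X (a s) (v s)) (combination X v a F)"
  using additive.finprod_insert[OF assms, of "\<lambda>s. vscale X (a s) (v s)"] v
  by (auto simp: combination_def additive_monoid_def scale_closed)

lemma combination_union:
  assumes "finite F" "finite G" "F \<inter> G = {}"
  shows "combination X v a (F \<union> G) = vadd X (combination X v a F) (combination X v a G)"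
  using additive.finprod_Un_disjoint[OF assms, of "\<lambda>s. vscale X (a s) (v s)"] v
  by (auto simp: combination_def additive_monoid_def scale_closed)

lemma combination_add:
  "finite F \<Longrightarrow> combination X v (\<lambda>s. a s + b s) F = vadd X (combination X v a F) (combination X v b F)"
  by (induction rule: finite_induct)
    (simp_all add: combination_empty combination_insert add_zero zero_closed scale_add_left v
      scale_closed combination_closed add_closed add_ac)

lemma combination_scale:
  "finite F \<Longrightarrow> combination X v (\<lambda>s. c * a s) F = vscale X c (combination X v a F)"
  by (induction rule: finite_induct)
    (simp_all add: combination_empty combination_insert scale_vzero scale_add_right v
      scale_closed combination_closed scale_scale)

lemma norm_combination_le:
  assumes "\<And>s. vnorm X (v s) \<le> C"
  shows "finite F \<Longrightarrow> vnorm X (combination X v a F) \<le> C * (\<Sum>s\<in>F. cmod (a s))"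
proof (induction rule: finite_induct)
  case (insert s F)
  have "vnorm X (combination X v a (insert s F))
      \<le> vnorm X (vscale X (a s) (v s)) + vnorm X (combination X v a F)"
    using insert by (simp add: combination_insert norm_triangle scale_closed v combination_closed)
  also have "\<dots> \<le> cmod (a s) * C + C * (\<Sum>s\<in>F. cmod (a s))"
    using insert.IH assms[of s] by (simp add: norm_scale v mult_left_mono add_mono)
  finally show ?case using insert.hyps by (simp add: algebra_simps)
qed (simp add: combination_empty norm_zero)

lemma vdist_combination_le:
  assumes C: "\<And>s. vnorm X (v s) \<le> C" and a: "a \<in> vcarrier ell1"
    and F: "finite F" and G: "finite G"
  shows "vdist X (combination X v a (F \<union> G)) (combination X v a F) \<le> C * ell1_tail a F"
proof -
  let ?F = "combination X v a F" and ?D = "combination X v a (G - F)"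
  have "combination X v a (F \<union> G) = vadd X ?F ?D"
    using combination_union[of F "G - F" a] F G by simp
  then have "vdist X (combination X v a (F \<union> G)) ?F = vdist X (vadd X ?F ?D) (vadd X ?F (vzero X))"
    by (simp add: add_zero combination_closed)
  also have "\<dots> \<le> vdist X ?F ?F + vdist X ?D (vzero X)"
    by (intro vdist_add combination_closed zero_closed)
  also have "\<dots> = vnorm X ?D"
    using minus_self[OF combination_closed] norm_zero
    by (simp add: vdist_zero_right combination_closed) (simp add: vdist_def)
  also have "\<dots> \<le> C * (\<Sum>s\<in>G - F. cmod (a s))"
    by (rule norm_combination_le[OF C]) (use G in simp)
  also have "\<dots> \<le> C * ell1_tail a F"
    using order_trans[OF norm_nonneg[OF v] C] G
    by (intro mult_left_mono sum_le_ell1_tail[OF a F]) auto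
  finally show ?thesis .
qed

end

end

text \<open>
  The sum $y = \sum_s a(s) v_s$ in \<open>X\<close>. The bound by tails, required for all finite \<open>F\<close> at once,
  expresses the convergence without a choice of enumeration, and it determines \<open>y\<close> since tails
  vanish in the limit. The witness is the limit of the partial sums along finite sets \<open>F n\<close> whose
  tails tend to zero, where two partial sums are compared through the one over the union of their
  index sets.
\<close>

lemma (in complex_banach_space) ex_combination_limit:
  assumes v: "\<And>s. v s \<in> vcarrier X" and C: "\<And>s. vnorm X (v s) \<le> C" and a: "a \<in> vcarrier ell1"
  shows "\<exists>y. y \<in> vcarrier X \<and> (\<forall>F. finite F \<longrightarrow> vdist X y (combination X v a F) \<le> C * ell1_tail a F)"
proof -
  interpret M: Metric_space "vcarrier X" "vdist X" by (rule Metric_space_vdist)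
  note S = combination_closed[where v = v, OF v]
  note le = vdist_combination_le[where v = v, OF v C a]
  have C0: "0 \<le> C" using order_trans[OF norm_nonneg[OF v] C] .
  have "\<exists>F. finite F \<and> ell1_tail a F < 1 / real (Suc n)" for n
    using order_tendstoD(2)[OF ell1_tail_tendsto[OF a], of "1 / real (Suc n)"]
    unfolding eventually_finite_subsets_at_top by auto
  then obtain F where F: "\<And>n. finite (F n)" "\<And>n. ell1_tail a (F n) < 1 / real (Suc n)"
    by metis
  let ?s = "\<lambda>n. combination X v a (F n)"
  \<comment> \<open>The partial sum over \<open>H \<union> G\<close> is close to the ones over \<open>H\<close> and over \<open>G\<close>.\<close>
  have two: "vdist X (combination X v a H) (combination X v a G) \<le> C * ell1_tail a H + C * ell1_tail a G"
    if "finite G" "finite H" for G H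
  proof -
    have "vdist X (combination X v a H) (combination X v a G)
        \<le> vdist X (combination X v a H) (combination X v a (H \<union> G))
          + vdist X (combination X v a (G \<union> H)) (combination X v a G)"
      using vdist_triangle[OF S S S] by (simp add: Un_commute)
    then show ?thesis
      using le[OF that] le[OF that(2,1)]
        vdist_commute[of "combination X v a H" "combination X v a (H \<union> G)"] by linarith
  qed
  have tail: "(\<lambda>n. C * ell1_tail a (F n)) \<longlonglongrightarrow> 0"
  proof (rule tendsto_mult_right_zero, rule tendsto_sandwich)
    show "\<forall>\<^sub>F n in sequentially. 0 \<le> ell1_tail a (F n)"
      using sum_le_ell1_tail[OF a F(1) finite.emptyI] by simp
    show "\<forall>\<^sub>F n in sequentially. ell1_tail a (F n) \<le> 1 / real (Suc n)"
      using F(2) by (simp add: less_imp_le)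
    show "(\<lambda>n. 1 / real (Suc n)) \<longlonglongrightarrow> 0"
      using LIMSEQ_inverse_real_of_nat by (simp add: inverse_eq_divide)
  qed simp
  have "M.MCauchy ?s"
    unfolding M.MCauchy_def
  proof (intro conjI allI impI)
    fix e :: real assume "e > 0"
    then obtain N where N: "\<And>n. n \<ge> N \<Longrightarrow> C * ell1_tail a (F n) < e / 2"
      using order_tendstoD(2)[OF tail, of "e / 2"] unfolding eventually_sequentially by auto
    have "vdist X (?s n) (?s m) < e" if "n \<ge> N" "m \<ge> N" for n m
      using two[OF F(1) F(1), of n m] N[OF that(1)] N[OF that(2)] by linarith
    then show "\<exists>N. \<forall>n n'. N \<le> n \<longrightarrow> N \<le> n' \<longrightarrow> vdist X (?s n) (?s n') < e" by blast
  qed (use S in auto)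
  then obtain y where "limitin M.mtopology ?s y sequentially"
    using complete unfolding M.mcomplete_def by blast
  then have y: "y \<in> vcarrier X" and lim: "\<And>e. e > 0 \<Longrightarrow> \<exists>N. \<forall>n\<ge>N. vdist X (?s n) y < e"
    unfolding M.limit_metric_sequentially by (auto, meson)
  have "(\<lambda>n. vdist X (?s n) y) \<longlonglongrightarrow> 0"
    unfolding LIMSEQ_iff using lim vdist_nonneg by simp
  then have ub: "(\<lambda>n. vdist X (?s n) y + (C * ell1_tail a (F n) + C * ell1_tail a G))
      \<longlonglongrightarrow> 0 + (0 + C * ell1_tail a G)" for G
    by (intro tendsto_add tail tendsto_const)
  have "vdist X y (combination X v a G) \<le> C * ell1_tail a G" if G: "finite G" for G
  proof -
    have "vdist X y (combination X v a G)
        \<le> vdist X (?s n) y + (C * ell1_tail a (F n) + C * ell1_tail a G)" for n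
      using vdist_triangle[OF y S[of a "F n"] S[of a G]] two[OF G F(1), of n] vdist_commute[of y "?s n"]
      by linarith
    then show ?thesis
      using LIMSEQ_le_const[OF ub[of G]] by auto
  qed
  then show ?thesis using y by blast
qed

text \<open>
  Existence in the universal property. Linearity passes from the partial sums to the limit, since
  the defect is bounded by a combination of tails, for every finite set. The bound \<open>C\<close> is kept
  explicit: it is what makes the extension of an action jointly bounded in \<open>a\<close> and \<open>x\<close>.
\<close>

theorem (in complex_banach_space) ell1_universal:
  fixes v :: "'s::semigroup_mult \<Rightarrow> 'x"
  assumes v: "\<And>s. v s \<in> vcarrier X" and C: "\<And>s. vnorm X (v s) \<le> C"
  obtains T where "linear_map (ell1 :: ('s \<Rightarrow> complex) nalgebra) X T"
    and "\<And>a. a \<in> vcarrier ell1 \<Longrightarrow> vnorm X (T a) \<le> C * vnorm ell1 a"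
    and "\<And>s. T (point_mass s) = v s"
proof -
  interpret ell1: complex_normed_space "ell1 :: ('s \<Rightarrow> complex) nalgebra"
    by (rule complex_normed_space_ell1)
  note S = combination_closed[where v = v, OF v]
  have "\<forall>a\<in>vcarrier (ell1 :: ('s \<Rightarrow> complex) nalgebra). \<exists>y. y \<in> vcarrier X \<and>
      (\<forall>F. finite F \<longrightarrow> vdist X y (combination X v a F) \<le> C * ell1_tail a F)"
    by (intro ballI ex_combination_limit v C)
  from bchoice[OF this] obtain T
    where T: "\<And>a. a \<in> vcarrier (ell1 :: ('s \<Rightarrow> complex) nalgebra) \<Longrightarrow> T a \<in> vcarrier X"
    "\<And>a F. \<lbrakk>a \<in> vcarrier (ell1 :: ('s \<Rightarrow> complex) nalgebra); finite F\<rbrakk>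
      \<Longrightarrow> vdist X (T a) (combination X v a F) \<le> C * ell1_tail a F"
    by auto
  have "T (vadd ell1 a b) = vadd X (T a) (T b)"
    if ab: "a \<in> vcarrier ell1" "b \<in> vcarrier ell1" for a b
  proof -
    note cl = T(1)[OF ell1.add_closed[OF ab]] add_closed[OF T(1)[OF ab(1)] T(1)[OF ab(2)]]
    have "vdist X (T (vadd ell1 a b)) (vadd X (T a) (T b))
        \<le> C * ell1_tail (vadd ell1 a b) F + (C * ell1_tail a F + C * ell1_tail b F)"
      if F: "finite F" for F
    proof -
      let ?a = "combination X v a F" and ?b = "combination X v b F"
      have "combination X v (vadd ell1 a b) F = vadd X ?a ?b"
        using combination_add[where v = v, OF v F, of a b] by (simp add: ell1_def)
      then have "vdist X (T (vadd ell1 a b)) (vadd X (T a) (T b))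
          \<le> vdist X (T (vadd ell1 a b)) (combination X v (vadd ell1 a b) F)
            + vdist X (vadd X (T a) (T b)) (vadd X ?a ?b)"
        using vdist_triangle[OF cl(1) S[of "vadd ell1 a b" F] cl(2)]
          vdist_commute[of "vadd X ?a ?b" "vadd X (T a) (T b)"] by simp
      also have "vdist X (vadd X (T a) (T b)) (vadd X ?a ?b) \<le> vdist X (T a) ?a + vdist X (T b) ?b"
        by (intro vdist_add S T(1) ab)
      finally show ?thesis
        using T(2)[OF ab(1) F] T(2)[OF ab(2) F] T(2)[OF ell1.add_closed[OF ab] F] by linarith
    qed
    then have "vdist X (T (vadd ell1 a b)) (vadd X (T a) (T b)) \<le> 0"
      by (rule nonpos_if_le_vanishing[where g = "\<lambda>F. C * ell1_tail (vadd ell1 a b) F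
            + (C * ell1_tail a F + C * ell1_tail b F)"])
        (assumption | intro tendsto_add_zero tendsto_mult_right_zero ell1_tail_tendsto ab ell1.add_closed)+
    then show ?thesis by (rule vdist_le_zeroD[OF cl])
  qed
  moreover have "T (vscale ell1 c a) = vscale X c (T a)" if a: "a \<in> vcarrier ell1" for c a
  proof -
    note cl = T(1)[OF ell1.scale_closed[OF a], of c] scale_closed[OF T(1)[OF a], of c]
    have "vdist X (T (vscale ell1 c a)) (vscale X c (T a))
        \<le> C * ell1_tail (vscale ell1 c a) F + cmod c * (C * ell1_tail a F)"
      if F: "finite F" for F
    proof -
      let ?a = "combination X v a F"
      have "combination X v (vscale ell1 c a) F = vscale X c ?a"
        using combination_scale[where v = v, OF v F, of c a] by (simp add: ell1_def)
      then have "vdist X (T (vscale ell1 c a)) (vscale X c (T a))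
          \<le> vdist X (T (vscale ell1 c a)) (combination X v (vscale ell1 c a) F)
            + vdist X (vscale X c (T a)) (vscale X c ?a)"
        using vdist_triangle[OF cl(1) S[of "vscale ell1 c a" F] cl(2)]
          vdist_commute[of "vscale X c ?a" "vscale X c (T a)"] by simp
      also have "vdist X (vscale X c (T a)) (vscale X c ?a) = cmod c * vdist X (T a) ?a"
        by (intro vdist_scale S T(1) a)
      finally show ?thesis
        using mult_left_mono[OF T(2)[OF a F] norm_ge_zero[of c]]
          T(2)[OF ell1.scale_closed[OF a, of c] F] by linarith
    qed
    then have "vdist X (T (vscale ell1 c a)) (vscale X c (T a)) \<le> 0"
      by (rule nonpos_if_le_vanishing[where g = "\<lambda>F. C * ell1_tail (vscale ell1 c a) F
            + cmod c * (C * ell1_tail a F)"])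
        (assumption | intro tendsto_add_zero tendsto_mult_right_zero ell1_tail_tendsto a ell1.scale_closed)+
    then show ?thesis by (rule vdist_le_zeroD[OF cl])
  qed
  ultimately have "linear_map ell1 X T" using T(1) by (auto simp: linear_map_def)
  moreover have "vnorm X (T a) \<le> C * vnorm ell1 a" if a: "a \<in> vcarrier ell1" for a
    \<comment> \<open>For the empty set of indices the partial sum is zero and the tail is the whole norm.\<close>
    using T(2)[OF a finite.emptyI] T(1)[OF a]
    by (simp add: combination_empty[where v = v, OF v] vdist_zero_right ell1_tail_def) (simp add: ell1_def)
  moreover have "T (point_mass s) = v s" for s
  proof -
    have "combination X v (point_mass s) {s} = v s"
      using combination_insert[where v = v, OF v, of "{}" s "point_mass s"]
      by (simp add: combination_empty[where v = v, OF v] point_mass_def scale_one v add_zero)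
    moreover have "ell1_tail (point_mass s) {s} = 0"
      using norm_point_mass[of s] by (simp add: ell1_tail_def ell1_def point_mass_def)
    ultimately show ?thesis
      using T(2)[OF point_mass_closed, of "{s}" s] T(1)[OF point_mass_closed] v vdist_le_zeroD by simp
  qed
  ultimately show ?thesis using that by blast
qed


section \<open>Bounded bilinear maps\<close>

text \<open>
  The two actions of a Banach module are of this kind, and so is the multiplication of a Banach
  algebra. With values in $\mathbb{C}$ such maps describe bounded linear maps into a dual space, see
  \<open>bounded_linear_map_into_dual\<close>.
\<close>

definition bounded_bilinear_map ::
    "('a, 'k) nspace_scheme \<Rightarrow> ('x, 'm) nspace_scheme \<Rightarrow> ('y, 'n) nspace_scheme
      \<Rightarrow> ('a \<Rightarrow> 'x \<Rightarrow> 'y) \<Rightarrow> bool" where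
  "bounded_bilinear_map A X Y V \<longleftrightarrow>
     (\<forall>a\<in>vcarrier A. linear_map X Y (V a)) \<and>
     (\<forall>x\<in>vcarrier X. linear_map A Y (\<lambda>a. V a x)) \<and>
     (\<exists>C. \<forall>a\<in>vcarrier A. \<forall>x\<in>vcarrier X. vnorm Y (V a x) \<le> C * vnorm A a * vnorm X x)"

lemma bounded_bilinear_map_fix:
  assumes "bounded_bilinear_map A X Y V"
  shows "a \<in> vcarrier A \<Longrightarrow> bounded_linear_map X Y (V a)"
    and "x \<in> vcarrier X \<Longrightarrow> bounded_linear_map A Y (\<lambda>a. V a x)"
proof -
  obtain C where C:
    "\<And>a x. \<lbrakk>a \<in> vcarrier A; x \<in> vcarrier X\<rbrakk> \<Longrightarrow> vnorm Y (V a x) \<le> C * vnorm A a * vnorm X x"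
    using assms unfolding bounded_bilinear_map_def by blast
  {
    assume a: "a \<in> vcarrier A"
    show "bounded_linear_map X Y (V a)"
      unfolding bounded_linear_map_def
      using assms C a by (auto simp: bounded_bilinear_map_def intro!: exI[of _ "C * vnorm A a"])
  }
  {
    assume x: "x \<in> vcarrier X"
    have "vnorm Y (V a x) \<le> (C * vnorm X x) * vnorm A a" if "a \<in> vcarrier A" for a
      using C[OF that x] by (simp add: mult.assoc mult.commute[of "vnorm X x"])
    then show "bounded_linear_map A Y (\<lambda>a. V a x)"
      unfolding bounded_linear_map_def
      using assms x by (auto simp: bounded_bilinear_map_def)
  }
qed

lemma bounded_bilinear_map_closed:
  "\<lbrakk>bounded_bilinear_map A X Y V; a \<in> vcarrier A; x \<in> vcarrier X\<rbrakk> \<Longrightarrow> V a x \<in> vcarrier Y"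
  by (auto simp: bounded_bilinear_map_def linear_map_def)

lemma bounded_bilinear_map_ell1_mult:
  "bounded_bilinear_map ell1 ell1 ell1 (amult (ell1 :: ('s::semigroup_mult \<Rightarrow> complex) nalgebra))"
proof -
  interpret ell1: complex_banach_algebra "ell1 :: ('s \<Rightarrow> complex) nalgebra"
    by (rule complex_banach_algebra_ell1)
  show ?thesis
    unfolding bounded_bilinear_map_def
    using ell1.mult_linear_left ell1.mult_linear_right ell1.norm_mult
    by (auto intro!: exI[of _ 1])
qed

lemma algebra_bimodule_alt:
  "algebra_bimodule A X l r \<longleftrightarrow>
     complex_banach_space X \<and> bounded_bilinear_map A X X l \<and> bounded_bilinear_map A X X r \<and>
     (\<forall>a\<in>vcarrier A. \<forall>b\<in>vcarrier A. \<forall>x\<in>vcarrier X. l (amult A a b) x = l a (l b x)) \<and>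
     (\<forall>a\<in>vcarrier A. \<forall>b\<in>vcarrier A. \<forall>x\<in>vcarrier X. r (amult A a b) x = r b (r a x)) \<and>
     (\<forall>a\<in>vcarrier A. \<forall>b\<in>vcarrier A. \<forall>x\<in>vcarrier X. l a (r b x) = r b (l a x))"
  unfolding algebra_bimodule_def bounded_bilinear_map_def by blast

text \<open>
  Currying. This reduces extending a derivation with values in the dual to extending scalar-valued
  families, so that completeness of $\mathbb{C}$ suffices. The restriction to the carrier is forced
  by the convention that functionals are \<open>extensional\<close>.
\<close>

lemma bounded_linear_map_into_dual:
  assumes X: "complex_normed_space X" and A: "complex_normed_space A"
    and V: "bounded_bilinear_map A X complex_space V"
  shows "bounded_linear_map A (dual X) (\<lambda>a. restrict (V a) (vcarrier X))"
proof -
  interpret X: complex_normed_space X by fact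
  interpret A: complex_normed_space A by fact
  obtain C where C:
    "\<And>a x. \<lbrakk>a \<in> vcarrier A; x \<in> vcarrier X\<rbrakk> \<Longrightarrow> cmod (V a x) \<le> C * vnorm A a * vnorm X x"
    using V unfolding bounded_bilinear_map_def by (auto simp: complex_space_def, blast)
  have dual: "restrict (V a) (vcarrier X) \<in> vcarrier (dual X)" if "a \<in> vcarrier A" for a
    using bounded_bilinear_map_fix(1)[OF V that] X.add_closed X.scale_closed
    by (auto simp: dual_def bounded_linear_map_def linear_map_def complex_space_def)
  have "vnorm (dual X) (restrict (V a) (vcarrier X)) \<le> \<bar>C\<bar> * vnorm A a" if a: "a \<in> vcarrier A" for a
  proof (rule X.dual_norm_least)
    fix x assume x: "x \<in> vcarrier X" "vnorm X x \<le> 1"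
    have "C * vnorm A a * vnorm X x \<le> \<bar>C\<bar> * vnorm A a * 1"
      using A.norm_nonneg[OF a] X.norm_nonneg[OF x(1)] x(2) by (intro mult_mono) auto
    then show "cmod (restrict (V a) (vcarrier X) x) \<le> \<bar>C\<bar> * vnorm A a"
      using C[OF a x(1)] x(1) by simp
  qed
  moreover have "linear_map A (dual X) (\<lambda>a. restrict (V a) (vcarrier X))"
    using dual bounded_bilinear_map_fix(2)[OF V]
    by (auto simp: linear_map_def bounded_linear_map_def fun_eq_iff)
      (auto simp: dual_def complex_space_def)
  ultimately show ?thesis by (auto simp: bounded_linear_map_def)
qed

text \<open>
  The universal property applied separately for each \<open>x\<close>. That the extension remains
  linear in \<open>x\<close> follows from uniqueness: both sides of each linearity equation are bounded
  linear in the element of $\ell^1(S)$ and agree on point masses.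
\<close>

lemma ell1_extend_family:
  fixes v :: "'s::semigroup_mult \<Rightarrow> 'x \<Rightarrow> 'y"
  assumes X: "complex_normed_space X" and Y: "complex_banach_space Y"
    and lin: "\<And>s. linear_map X Y (v s)"
    and bound: "\<And>s x. x \<in> vcarrier X \<Longrightarrow> vnorm Y (v s x) \<le> C * vnorm X x"
  obtains V where "bounded_bilinear_map (ell1 :: ('s \<Rightarrow> complex) nalgebra) X Y V"
    and "\<And>s x. x \<in> vcarrier X \<Longrightarrow> V (point_mass s) x = v s x"
proof -
  let ?A = "ell1 :: ('s \<Rightarrow> complex) nalgebra"
  interpret X: complex_normed_space X by fact
  interpret Y: complex_banach_space Y by fact
  note A = complex_normed_space_ell1 and Yn = Y.complex_normed_space_axioms
  have "\<exists>T. linear_map ?A Y T \<and>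
      (\<forall>a\<in>vcarrier ?A. vnorm Y (T a) \<le> C * vnorm X x * vnorm ?A a) \<and>
      (\<forall>s. T (point_mass s) = v s x)" if x: "x \<in> vcarrier X" for x
    using Y.ell1_universal[of "\<lambda>s. v s x" "C * vnorm X x"] linear_mapD(1)[OF lin x] bound[OF x]
    by metis
  then obtain W where W: "\<And>x. x \<in> vcarrier X \<Longrightarrow> linear_map ?A Y (W x)"
    "\<And>x a. \<lbrakk>x \<in> vcarrier X; a \<in> vcarrier ?A\<rbrakk> \<Longrightarrow> vnorm Y (W x a) \<le> C * vnorm X x * vnorm ?A a"
    "\<And>x s. x \<in> vcarrier X \<Longrightarrow> W x (point_mass s) = v s x"
    using bchoice[OF ballI, of "vcarrier X"] by (metis (no_types, lifting))
  have Wb: "bounded_linear_map ?A Y (W x)" if "x \<in> vcarrier X" for x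
    using W(1,2)[OF that] unfolding bounded_linear_map_def by blast
  have "linear_map X Y (\<lambda>x. W x a)" if a: "a \<in> vcarrier ?A" for a
    unfolding linear_map_def
  proof (intro conjI ballI allI)
    fix x assume x: "x \<in> vcarrier X"
    show "W x a \<in> vcarrier Y" using linear_mapD(1)[OF W(1)[OF x] a] .
    show "W (vscale X c x) a = vscale Y c (W x a)" for c
      by (rule ell1_bounded_linear_eqI[OF Yn Wb bounded_linear_map_scale[OF A Yn Wb] _ a])
        (simp_all add: W(3) x X.scale_closed linear_mapD(3)[OF lin])
    fix y assume y: "y \<in> vcarrier X"
    show "W (vadd X x y) a = vadd Y (W x a) (W y a)"
      by (rule ell1_bounded_linear_eqI[OF Yn Wb bounded_linear_map_add[OF A Yn Wb Wb] _ a])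
        (simp_all add: W(3) x y X.add_closed linear_mapD(2)[OF lin])
  qed
  moreover have "vnorm Y (W x a) \<le> C * vnorm ?A a * vnorm X x"
    if "a \<in> vcarrier ?A" "x \<in> vcarrier X" for a x
    using W(2)[OF that(2,1)] by (simp add: mult.assoc mult.commute[of "vnorm X x"])
  ultimately have "bounded_bilinear_map ?A X Y (\<lambda>a x. W x a)"
    using W(1) unfolding bounded_bilinear_map_def by blast
  then show ?thesis using that[of "\<lambda>a x. W x a"] W(3) by blast
qed

section \<open>Modules and derivations over the semigroup and over its algebra\<close>

text \<open>
  On point masses the three module laws are those of the semigroup, by \<open>point_mass_mult\<close>; all
  sides are bounded bilinear in the two algebra elements.
\<close>

lemma ell1_bimodule_of_semigroup_bimodule:
  fixes l r :: "'s::semigroup_mult \<Rightarrow> 'x \<Rightarrow> 'x"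
  assumes S: "semigroup_bimodule X l r"
    and L: "bounded_bilinear_map (ell1 :: ('s \<Rightarrow> complex) nalgebra) X X L"
    and R: "bounded_bilinear_map (ell1 :: ('s \<Rightarrow> complex) nalgebra) X X R"
    and Ll: "\<And>s x. x \<in> vcarrier X \<Longrightarrow> L (point_mass s) x = l s x"
    and Rr: "\<And>s x. x \<in> vcarrier X \<Longrightarrow> R (point_mass s) x = r s x"
  shows "algebra_bimodule ell1 X L R"
proof -
  let ?A = "ell1 :: ('s \<Rightarrow> complex) nalgebra"
  have X: "complex_normed_space X"
    using S by (simp add: semigroup_bimodule_def complex_banach_space_def)
  note A = complex_normed_space_ell1
  note mult = bounded_bilinear_map_fix[OF bounded_bilinear_map_ell1_mult]
  note Lb = bounded_bilinear_map_fix[OF L] and Rb = bounded_bilinear_map_fix[OF R]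
  note Lc = bounded_bilinear_map_closed[OF L] and Rc = bounded_bilinear_map_closed[OF R]
  have lc: "l s x \<in> vcarrier X" and rc: "r s x \<in> vcarrier X" if "x \<in> vcarrier X" for s x
    using S that by (auto simp: semigroup_bimodule_def linear_map_def)
  have ids: "l (s * t) x = l s (l t x)" "r (s * t) x = r t (r s x)" "l s (r t x) = r t (l s x)"
    if "x \<in> vcarrier X" for s t x
    using S that by (auto simp: semigroup_bimodule_def)
  show ?thesis
    unfolding algebra_bimodule_alt
  proof (intro conjI ballI)
    show "complex_banach_space X" using S by (simp add: semigroup_bimodule_def)
    fix a b :: "'s \<Rightarrow> complex" and x
    assume ab: "a \<in> vcarrier ell1" "b \<in> vcarrier ell1" and x: "x \<in> vcarrier X"
    show "L (amult ell1 a b) x = L a (L b x)"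
      by (rule ell1_bilinear_eqI[OF X, where B = "\<lambda>a b. L (amult ell1 a b) x"
            and B' = "\<lambda>a b. L a (L b x)"])
        (simp_all add: ab point_mass_mult Ll x lc ids Lc Lb(2)
          bounded_linear_map_compose[OF A A mult(1) Lb(2)[OF x]]
          bounded_linear_map_compose[OF A A mult(2) Lb(2)[OF x]]
          bounded_linear_map_compose[OF A X Lb(2) Lb(1)])
    show "R (amult ell1 a b) x = R b (R a x)"
      by (rule ell1_bilinear_eqI[OF X, where B = "\<lambda>a b. R (amult ell1 a b) x"
            and B' = "\<lambda>a b. R b (R a x)"])
        (simp_all add: ab point_mass_mult Rr x rc ids Rc Rb(2)
          bounded_linear_map_compose[OF A A mult(1) Rb(2)[OF x]]
          bounded_linear_map_compose[OF A A mult(2) Rb(2)[OF x]]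
          bounded_linear_map_compose[OF A X Rb(2) Rb(1)])
    show "L a (R b x) = R b (L a x)"
      by (rule ell1_bilinear_eqI[OF X, where B = "\<lambda>a b. L a (R b x)"
            and B' = "\<lambda>a b. R b (L a x)"])
        (simp_all add: ab Rr Ll x rc lc ids Rc Lc Lb(2) Rb(2)
          bounded_linear_map_compose[OF A X Lb(2) Rb(1)]
          bounded_linear_map_compose[OF A X Rb(2) Lb(1)])
  qed (use L R in auto)
qed

text \<open>
  This matches the modules on which the semigroup acts through \<open>\<phi>\<close> with those on which the algebra
  acts through the induced character. It serves for left and right actions alike.
\<close>

lemma scalar_action_of_point_masses:
  fixes \<phi> :: "'s::semigroup_mult \<Rightarrow> complex"
  assumes \<phi>: "\<phi> \<in> semigroup_characters" and X: "complex_normed_space X"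
    and L: "bounded_bilinear_map ell1 X X L"
    and eq: "\<And>s. L (point_mass s) x = vscale X (\<phi> s) x"
    and a: "a \<in> vcarrier ell1" and x: "x \<in> vcarrier X"
  shows "L a x = vscale X (induced_character \<phi> a) x"
proof -
  interpret X: complex_normed_space X by fact
  have "bounded_linear_map complex_space X (\<lambda>c. vscale X c x)"
    unfolding bounded_linear_map_def linear_map_def
    using X.norm_scale[OF x] mult.commute[of _ "vnorm X x"]
    by (auto simp: complex_space_def X.scale_closed X.scale_add_left X.scale_scale x
        intro!: exI[of _ "vnorm X x"])
  from bounded_linear_map_compose[OF complex_normed_space_ell1 complex_normed_space_complex
      bounded_linear_map_induced_character[OF \<phi>] this]
  show ?thesis
    by (rule ell1_bounded_linear_eqI[OF X bounded_bilinear_map_fix(2)[OF L x] _ _ a])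
      (simp add: eq induced_character_point_mass)
qed

text \<open>
  After evaluation at \<open>x\<close>, both sides of the derivation identity are bounded bilinear scalar-valued
  maps of the two algebra elements.
\<close>

lemma derivation_of_point_masses:
  fixes L R :: "('s::semigroup_mult \<Rightarrow> complex) \<Rightarrow> 'x \<Rightarrow> 'x"
  assumes M: "algebra_bimodule ell1 X L R" and D: "bounded_linear_map ell1 (dual X) D"
    and eq: "\<And>s t x. x \<in> vcarrier X \<Longrightarrow> D (point_mass (s * t)) x
      = D (point_mass t) (R (point_mass s) x) + D (point_mass s) (L (point_mass t) x)"
  shows "algebra_continuous_derivation ell1 X L R D"
proof -
  have X: "complex_normed_space X"
    and L: "bounded_bilinear_map ell1 X X L" and R: "bounded_bilinear_map ell1 X X R"
    using M by (auto simp: algebra_bimodule_alt complex_banach_space_def)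
  interpret X: complex_normed_space X by fact
  note A = complex_normed_space_ell1 and C = complex_normed_space_complex
  note X' = X.complex_normed_space_dual
  note mult = bounded_bilinear_map_fix[OF bounded_bilinear_map_ell1_mult]
  note Lb = bounded_bilinear_map_fix[OF L] and Rb = bounded_bilinear_map_fix[OF R]
  note Lc = bounded_bilinear_map_closed[OF L] and Rc = bounded_bilinear_map_closed[OF R]
  note Dc = bounded_linear_mapD(2)[OF D]
  have Dx: "bounded_linear_map ell1 complex_space (\<lambda>a. D a x)" if "x \<in> vcarrier X" for x
    by (rule bounded_linear_map_compose[OF A X' D bounded_linear_map_dual_eval[OF X that]])
  have pt: "D (amult ell1 a b) x = D b (R a x) + D a (L b x)"
    if ab: "a \<in> vcarrier ell1" "b \<in> vcarrier ell1" and x: "x \<in> vcarrier X" for a b x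
  proof -
    have "D (amult ell1 a b) x = vadd complex_space (D b (R a x)) (D a (L b x))"
      by (rule ell1_bilinear_eqI[OF C, where B = "\<lambda>a b. D (amult ell1 a b) x"
            and B' = "\<lambda>a b. vadd complex_space (D b (R a x)) (D a (L b x))"])
        (simp_all add: ab x Lc Rc Dx point_mass_mult
          bounded_linear_map_compose[OF A A mult(1) Dx[OF x]]
          bounded_linear_map_compose[OF A A mult(2) Dx[OF x]]
          bounded_linear_map_add[OF A C]
          bounded_linear_map_compose[OF A X Lb(2) dual_bounded_linear_map[OF Dc]]
          bounded_linear_map_compose[OF A X Rb(2) dual_bounded_linear_map[OF Dc]] eq,
          simp add: complex_space_def)
    then show ?thesis by (simp add: complex_space_def)
  qed
  have ext: "D a \<in> extensional (vcarrier X)" if "a \<in> vcarrier ell1" for a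
    using Dc[OF that] by (simp add: dual_def)
  have "D (amult ell1 a b) = vadd (dual X) (dual_left X R a (D b)) (dual_right X L (D a) b)"
    if ab: "a \<in> vcarrier ell1" "b \<in> vcarrier ell1" for a b
    by (rule extensionalityI[OF ext[OF ell1_mult_closed(1)[OF ab]]])
      (simp_all add: dual_def dual_left_def dual_right_def pt[OF ab])
  then show ?thesis
    using continuous_map_iff_bounded[OF A X' bounded_linear_mapD(1)[OF D]] D
    by (simp add: algebra_continuous_derivation_def bounded_linear_mapD(1))
qed

text \<open>
  For fixed \<open>x\<close>, all terms of $D(a)(x) = f(x \cdot a) - f(a \cdot x)$ are bounded linear in \<open>a\<close>.
\<close>

lemma inner_of_point_masses:
  fixes L R :: "('s::semigroup_mult \<Rightarrow> complex) \<Rightarrow> 'x \<Rightarrow> 'x"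
  assumes M: "algebra_bimodule ell1 X L R" and D: "bounded_linear_map ell1 (dual X) D"
    and f: "f \<in> vcarrier (dual X)"
    and eq: "\<And>s x. x \<in> vcarrier X \<Longrightarrow>
      D (point_mass s) x = f (R (point_mass s) x) - f (L (point_mass s) x)"
  shows "algebra_inner ell1 X L R D"
proof -
  have X: "complex_normed_space X"
    and L: "bounded_bilinear_map ell1 X X L" and R: "bounded_bilinear_map ell1 X X R"
    using M by (auto simp: algebra_bimodule_alt complex_banach_space_def)
  interpret X: complex_normed_space X by fact
  note A = complex_normed_space_ell1 and C = complex_normed_space_complex
  note f' = dual_bounded_linear_map[OF f]
  have "D a x = f (R a x) - f (L a x)" if a: "a \<in> vcarrier ell1" and x: "x \<in> vcarrier X" for a x
  proof -
    have "D a x = vadd complex_space (f (R a x)) (vscale complex_space (- 1) (f (L a x)))"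
      by (rule ell1_bounded_linear_eqI[OF C bounded_linear_map_compose[OF A
              X.complex_normed_space_dual D bounded_linear_map_dual_eval[OF X x]]
            bounded_linear_map_add[OF A C
              bounded_linear_map_compose[OF A X bounded_bilinear_map_fix(2)[OF R x] f']
              bounded_linear_map_scale[OF A C
                bounded_linear_map_compose[OF A X bounded_bilinear_map_fix(2)[OF L x] f']]] _ a])
        (simp add: eq x complex_space_def)
    then show ?thesis by (simp add: complex_space_def)
  qed
  moreover have "D a \<in> extensional (vcarrier X)" if "a \<in> vcarrier ell1" for a
    using bounded_linear_mapD(2)[OF D that] by (simp add: dual_def)
  ultimately have "D a = vminus (dual X) (dual_left X R a f) (dual_right X L f a)"
    if "a \<in> vcarrier ell1" for a
    using that by (intro extensionalityI[of _ "vcarrier X"])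
      (simp_all add: vminus_def dual_def dual_left_def dual_right_def)
  then show ?thesis using f by (auto simp: algebra_inner_def)
qed

lemma semigroup_derivation_extends:
  fixes l r :: "'s::semigroup_mult \<Rightarrow> 'x \<Rightarrow> 'x"
  assumes S: "semigroup_bimodule X l r" and D: "semigroup_bounded_derivation X l r D"
  obtains L R E where "algebra_bimodule (ell1 :: ('s \<Rightarrow> complex) nalgebra) X L R"
    and "algebra_continuous_derivation ell1 X L R E"
    and "\<And>s x. x \<in> vcarrier X \<Longrightarrow> L (point_mass s) x = l s x"
    and "\<And>s x. x \<in> vcarrier X \<Longrightarrow> R (point_mass s) x = r s x"
    and "\<And>s. E (point_mass s) = D s"
proof -
  have B: "complex_banach_space X" and X: "complex_normed_space X"
    using S by (auto simp: semigroup_bimodule_def complex_banach_space_def)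
  interpret X: complex_normed_space X by fact
  obtain L where L: "bounded_bilinear_map (ell1 :: ('s \<Rightarrow> complex) nalgebra) X X L"
    "\<And>s x. x \<in> vcarrier X \<Longrightarrow> L (point_mass s) x = l s x"
    using S ell1_extend_family[OF X B, of l] unfolding semigroup_bimodule_def by metis
  obtain R where R: "bounded_bilinear_map (ell1 :: ('s \<Rightarrow> complex) nalgebra) X X R"
    "\<And>s x. x \<in> vcarrier X \<Longrightarrow> R (point_mass s) x = r s x"
    using S ell1_extend_family[OF X B, of r] unfolding semigroup_bimodule_def by metis
  have M: "algebra_bimodule ell1 X L R"
    by (rule ell1_bimodule_of_semigroup_bimodule[OF S L(1) R(1) L(2) R(2)])
  have Dd: "D s \<in> vcarrier (dual X)" for s
    using D by (simp add: semigroup_bounded_derivation_def)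
  obtain K where K: "\<And>s. vnorm (dual X) (D s) \<le> K"
    using D by (auto simp: semigroup_bounded_derivation_def bdd_above_def)
  have "vnorm complex_space (D s x) \<le> K * vnorm X x" if x: "x \<in> vcarrier X" for s x
    using X.dual_norm_bound[OF Dd x, of s] mult_right_mono[OF K X.norm_nonneg[OF x], of s]
    by (simp add: complex_space_def)
  then obtain V where V: "bounded_bilinear_map (ell1 :: ('s \<Rightarrow> complex) nalgebra) X complex_space V"
    "\<And>s x. x \<in> vcarrier X \<Longrightarrow> V (point_mass s) x = D s x"
    using ell1_extend_family[OF X complex_banach_space_complex, of D K]
      bounded_linear_mapD(1)[OF dual_bounded_linear_map[OF Dd]] by metis
  let ?E = "\<lambda>a. restrict (V a) (vcarrier X)"
  have E: "?E (point_mass s) = D s" for s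
    using Dd[of s] V(2) by (auto simp: fun_eq_iff dual_def extensional_def)
  have "algebra_continuous_derivation ell1 X L R ?E"
  proof (rule derivation_of_point_masses[OF M
        bounded_linear_map_into_dual[OF X complex_normed_space_ell1 V(1)]])
    fix s t x assume x: "x \<in> vcarrier X"
    have "D (s * t) = vadd (dual X) (dual_left X r s (D t)) (dual_right X l (D s) t)"
      using D by (simp add: semigroup_bounded_derivation_def)
    then have "D (s * t) x = D t (r s x) + D s (l t x)"
      using x by (simp add: dual_def dual_left_def dual_right_def)
    then show "?E (point_mass (s * t)) x
        = ?E (point_mass t) (R (point_mass s) x) + ?E (point_mass s) (L (point_mass t) x)"
      unfolding E L(2)[OF x] R(2)[OF x] .
  qed
  then show ?thesis using that M L(2) R(2) E by blast
qed

text \<open>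
  Since point masses have norm one, the bounds for the algebra turn into bounds that are uniform over
  the semigroup; for the derivation this uses that continuity is boundedness.
\<close>

lemma ell1_derivation_restricts:
  fixes L R :: "('s::semigroup_mult \<Rightarrow> complex) \<Rightarrow> 'x \<Rightarrow> 'x"
  assumes M: "algebra_bimodule ell1 X L R" and D: "algebra_continuous_derivation ell1 X L R D"
  shows "semigroup_bimodule X (\<lambda>s. L (point_mass s)) (\<lambda>s. R (point_mass s))"
    and "semigroup_bounded_derivation X (\<lambda>s. L (point_mass s)) (\<lambda>s. R (point_mass s))
      (\<lambda>s. D (point_mass s))"
proof -
  have X: "complex_normed_space X"
    and L: "bounded_bilinear_map ell1 X X L" and R: "bounded_bilinear_map ell1 X X R"
    using M by (auto simp: algebra_bimodule_alt complex_banach_space_def)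
  interpret X: complex_normed_space X by fact
  interpret ell1: complex_normed_space "ell1 :: ('s \<Rightarrow> complex) nalgebra"
    by (rule complex_normed_space_ell1)
  have bound: "\<exists>C. \<forall>s. \<forall>x\<in>vcarrier X. vnorm X (V (point_mass s) x) \<le> C * vnorm X x"
    if "bounded_bilinear_map ell1 X X V" for V :: "('s \<Rightarrow> complex) \<Rightarrow> 'x \<Rightarrow> 'x"
  proof -
    obtain C where "\<And>a x. \<lbrakk>a \<in> vcarrier ell1; x \<in> vcarrier X\<rbrakk>
        \<Longrightarrow> vnorm X (V a x) \<le> C * vnorm ell1 a * vnorm X x"
      using \<open>bounded_bilinear_map ell1 X X V\<close> unfolding bounded_bilinear_map_def by blast
    from this[OF point_mass_closed] show ?thesis by (auto simp: norm_point_mass)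
  qed
  show "semigroup_bimodule X (\<lambda>s. L (point_mass s)) (\<lambda>s. R (point_mass s))"
    unfolding semigroup_bimodule_def point_mass_mult[symmetric]
    using M bound[OF L] bound[OF R] by (simp add: algebra_bimodule_def point_mass_closed)
  have lin: "linear_map ell1 (dual X) D" using D by (simp add: algebra_continuous_derivation_def)
  then have "bounded_linear_map ell1 (dual X) D"
    using D continuous_map_iff_bounded[OF complex_normed_space_ell1 X.complex_normed_space_dual lin]
    by (simp add: algebra_continuous_derivation_def)
  then obtain C where "\<And>a. a \<in> vcarrier ell1 \<Longrightarrow> vnorm (dual X) (D a) \<le> C * vnorm ell1 a"
    by (auto simp: bounded_linear_map_def)
  from this[OF point_mass_closed] have "bdd_above (range (\<lambda>s. vnorm (dual X) (D (point_mass s))))"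
    by (auto simp: norm_point_mass intro!: bdd_aboveI2)
  then show "semigroup_bounded_derivation X (\<lambda>s. L (point_mass s)) (\<lambda>s. R (point_mass s))
      (\<lambda>s. D (point_mass s))"
    using D linear_mapD(1)[OF lin point_mass_closed]
    by (simp add: semigroup_bounded_derivation_def algebra_continuous_derivation_def
        point_mass_mult[symmetric] point_mass_closed dual_left_def dual_right_def)
qed

lemma principal_if_extension_inner:
  assumes inner: "algebra_inner ell1 X L R E"
    and "\<And>s x. x \<in> vcarrier X \<Longrightarrow> L (point_mass s) x = l s x"
    and "\<And>s x. x \<in> vcarrier X \<Longrightarrow> R (point_mass s) x = r s x"
    and "\<And>s. E (point_mass s) = D s"
  shows "semigroup_principal X l r D"
proof -
  have "dual_left X R (point_mass s) f = dual_left X r s f"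
    "dual_right X L f (point_mass s) = dual_right X l f s" for s f
    using assms by (auto simp: dual_left_def dual_right_def fun_eq_iff)
  then show ?thesis
    using inner assms(4) point_mass_closed unfolding algebra_inner_def semigroup_principal_def
    by metis
qed

lemma inner_if_restriction_principal:
  fixes L R :: "('s::semigroup_mult \<Rightarrow> complex) \<Rightarrow> 'x \<Rightarrow> 'x"
  assumes M: "algebra_bimodule ell1 X L R" and D: "algebra_continuous_derivation ell1 X L R D"
    and principal: "semigroup_principal X (\<lambda>s. L (point_mass s)) (\<lambda>s. R (point_mass s))
      (\<lambda>s. D (point_mass s))"
  shows "algebra_inner ell1 X L R D"
proof -
  have X: "complex_normed_space X"
    using M by (auto simp: algebra_bimodule_alt complex_banach_space_def)
  have lin: "linear_map ell1 (dual X) D" using D by (simp add: algebra_continuous_derivation_def)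
  have Db: "bounded_linear_map ell1 (dual X) D"
    using D continuous_map_iff_bounded[OF complex_normed_space_ell1
        complex_normed_space.complex_normed_space_dual[OF X] lin]
    by (simp add: algebra_continuous_derivation_def)
  obtain f where f: "f \<in> vcarrier (dual X)"
    "\<And>s. D (point_mass s) = vminus (dual X)
        (dual_left X (\<lambda>s. R (point_mass s)) s f) (dual_right X (\<lambda>s. L (point_mass s)) f s)"
    using principal by (auto simp: semigroup_principal_def)
  show ?thesis
    by (rule inner_of_point_masses[OF M Db f(1)])
      (simp add: f(2) vminus_def dual_def dual_left_def dual_right_def)
qed

section \<open>The equivalence of the two amenability notions\<close>

theorem theorem2p9:
  fixes \<phi> :: "'s::semigroup_mult \<Rightarrow> complex"
  assumes "\<phi> \<in> semigroup_characters"
  shows "semigroup_amenable TYPE('x) \<phi> \<longleftrightarrow>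
    algebra_amenable TYPE('x) (ell1 :: ('s \<Rightarrow> complex) nalgebra) (induced_character \<phi>)"
proof
  let ?A = "ell1 :: ('s \<Rightarrow> complex) nalgebra" and ?\<psi> = "induced_character \<phi>"
  {
    \<comment> \<open>Both classes of modules are treated at once, since restriction preserves the scalar side.\<close>
    assume S: "semigroup_amenable TYPE('x) \<phi>"
    have "algebra_inner ?A X L R D"
      if M: "algebra_bimodule ?A X L R" and D: "algebra_continuous_derivation ?A X L R D"
        and scalar: "(\<forall>a\<in>vcarrier ?A. \<forall>x\<in>vcarrier X. L a x = vscale X (?\<psi> a) x) \<or>
          (\<forall>a\<in>vcarrier ?A. \<forall>x\<in>vcarrier X. R a x = vscale X (?\<psi> a) x)"
      for X :: "'x nspace" and L R D
    proof (rule inner_if_restriction_principal[OF M D])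
      have "(\<forall>s. \<forall>x\<in>vcarrier X. L (point_mass s) x = vscale X (\<phi> s) x) \<or>
          (\<forall>s. \<forall>x\<in>vcarrier X. R (point_mass s) x = vscale X (\<phi> s) x)"
        using scalar point_mass_closed by (metis induced_character_point_mass)
      then show "semigroup_principal X (\<lambda>s. L (point_mass s)) (\<lambda>s. R (point_mass s))
          (\<lambda>s. D (point_mass s))"
        using S ell1_derivation_restricts[OF M D]
        unfolding semigroup_amenable_def semigroup_left_amenable_def semigroup_right_amenable_def
        by blast
    qed
    then show "algebra_amenable TYPE('x) ?A ?\<psi>"
      unfolding algebra_amenable_def by blast
  }
  {
    assume A: "algebra_amenable TYPE('x) ?A ?\<psi>"
    have "semigroup_principal X l r D"
      if S: "semigroup_bimodule X l r" and D: "semigroup_bounded_derivation X l r D"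
        and scalar: "(\<forall>s. \<forall>x\<in>vcarrier X. l s x = vscale X (\<phi> s) x) \<or>
          (\<forall>s. \<forall>x\<in>vcarrier X. r s x = vscale X (\<phi> s) x)"
      for X :: "'x nspace" and l r :: "'s \<Rightarrow> 'x \<Rightarrow> 'x" and D
    proof -
      obtain L R E where M: "algebra_bimodule ?A X L R"
        and E: "algebra_continuous_derivation ?A X L R E"
        and ext: "\<And>s x. x \<in> vcarrier X \<Longrightarrow> L (point_mass s) x = l s x"
          "\<And>s x. x \<in> vcarrier X \<Longrightarrow> R (point_mass s) x = r s x"
          "\<And>s. E (point_mass s) = D s"
        using semigroup_derivation_extends[OF S D] by metis
      have X: "complex_normed_space X"
        and LR: "bounded_bilinear_map ?A X X L" "bounded_bilinear_map ?A X X R"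
        using M by (auto simp: algebra_bimodule_alt complex_banach_space_def)
      have "(\<forall>a\<in>vcarrier ?A. \<forall>x\<in>vcarrier X. L a x = vscale X (?\<psi> a) x) \<or>
          (\<forall>a\<in>vcarrier ?A. \<forall>x\<in>vcarrier X. R a x = vscale X (?\<psi> a) x)"
        using scalar
      proof
        assume "\<forall>s. \<forall>x\<in>vcarrier X. l s x = vscale X (\<phi> s) x"
        then show ?thesis
          using scalar_action_of_point_masses[OF assms X LR(1)] ext(1) by simp
      next
        assume "\<forall>s. \<forall>x\<in>vcarrier X. r s x = vscale X (\<phi> s) x"
        then show ?thesis
          using scalar_action_of_point_masses[OF assms X LR(2)] ext(2) by simp
      qed
      then have "algebra_inner ?A X L R E"
        using A M E unfolding algebra_amenable_def by blast
      then show ?thesis using ext by (rule principal_if_extension_inner)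
    qed
    then show "semigroup_amenable TYPE('x) \<phi>"
      unfolding semigroup_amenable_def semigroup_left_amenable_def semigroup_right_amenable_def
      by blast
  }
qed

end
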